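(* Let $(X,\rho)$ be a $\tau$-uniformly perfect $K$-quasi-metric space which carries a doubling measure $\mu$ with coefficient $C_\mu\ge1$. (1) If $X$ is bounded and $c\in X$, then the flattening measure $\mu^c$ on $(X^c,\rho^c)$ is doubling. (2) If $X$ is unbounded and $a\in X$, then the spherical measure $\mu_a$ on $(\dot X,\rho_a)$ is doubling.
   Context: A $K$-quasi-metric ($K\ge1$) on a set $X$ is a symmetric function $\rho:X\times X\to[0,\infty)$ with $\rho(x,y)=0$ iff $x=y$ and $\rho(x,z)\le K\max\{\rho(x,y),\rho(y,z)\}$ for all $x,y,z\in X$. Balls are $B(x,r)=\{y\in X:\rho(x,y)<r\}$. $(X,\rho)$ is $\tau$-uniformly perfect, $\tau\in(0,1)$, if for each $x\in X$ and every $r>0$ with $X\setminus B(x,r)\neq\emptyset$ one has $B(x,r)\setminus B(x,\tau r)\ne\emptyset$. A positive Borel measure $\mu$ (Borel regular, with dense support, and $0<\mu(B)<\infty$ for every ball $B$) is doubling with coefficient $C_\mu$ if $\mu(B(x,2r))\le C_\mu\,\mu(B(x,r))$ for all $x\in X$ and $r>0$. Flattening ($X$ bounded, $c\in X$): $X^c=X\setminus\{c\}$, $\rho^c(x,y)=\dfrac{\rho(x,y)}{\rho(x,c)\rho(y,c)}$, and $\mu^c(A)=\displaystyle\int_A\frac{1}{\mu(B(c,\rho(c,z)))^2}\,d\mu(z)$ for Borel $A\subset X^c$. Sphericalization ($X$ unbounded, $a\in X$): $\dot X=X\cup\{\infty\}$, $\rho_a$ symmetric with $\rho_a(x,y)=\dfrac{\rho(x,y)}{[1+\rho(x,a)][1+\rho(y,a)]}$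 for $x,y\in X$, $\rho_a(x,\infty)=\dfrac1{1+\rho(x,a)}$ for $x\in X$, $\rho_a(\infty,\infty)=0$, and $\mu_a(A)=\displaystyle\int_{A\setminus\{\infty\}}\frac{1}{\mu(B(a,1+\rho(a,z)))^2}\,d\mu(z)$ for Borel $A\subset\dot X$. The functions $\rho^c$ and $\rho_a$ are quasi-metrics. *)

theory Defs
  imports "HOL-Analysis.Analysis"
begin

definition quasi_metric_on :: "real \<Rightarrow> 'a set \<Rightarrow> ('a \<Rightarrow> 'a \<Rightarrow> real) \<Rightarrow> bool" where
  "quasi_metric_on K X \<rho> \<longleftrightarrow>
     1 \<le> K \<and>
     (\<forall>x\<in>X. \<forall>y\<in>X. 0 \<le> \<rho> x y) \<and>
     (\<forall>x\<in>X. \<forall>y\<in>X. \<rho> x y = \<rho> y x) \<and>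
     (\<forall>x\<in>X. \<forall>y\<in>X. \<rho> x y = 0 \<longleftrightarrow> x = y) \<and>
     (\<forall>x\<in>X. \<forall>y\<in>X. \<forall>z\<in>X. \<rho> x z \<le> K * max (\<rho> x y) (\<rho> y z))"

definition qball :: "'a set \<Rightarrow> ('a \<Rightarrow> 'a \<Rightarrow> real) \<Rightarrow> 'a \<Rightarrow> real \<Rightarrow> 'a set" where
  "qball X \<rho> x r = {y \<in> X. \<rho> x y < r}"

definition qbounded :: "'a set \<Rightarrow> ('a \<Rightarrow> 'a \<Rightarrow> real) \<Rightarrow> bool" where
  "qbounded X \<rho> \<longleftrightarrow> (\<exists>R. \<forall>x\<in>X. \<forall>y\<in>X. \<rho> x y \<le> R)"

definition uniformly_perfect :: "real \<Rightarrow> 'a set \<Rightarrow> ('a \<Rightarrow> 'a \<Rightarrow> real) \<Rightarrow> bool" where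
  "uniformly_perfect \<tau> X \<rho> \<longleftrightarrow>
     0 < \<tau> \<and> \<tau> < 1 \<and>
     (\<forall>x\<in>X. \<forall>r>0. X - qball X \<rho> x r \<noteq> {} \<longrightarrow> qball X \<rho> x r - qball X \<rho> x (\<tau> * r) \<noteq> {})"

text \<open>The topology induced by \<open>\<rho>\<close>. Balls of a quasi-metric are neighbourhoods of their centres,
  but they need not be open, nor even Borel.\<close>

definition qtopology :: "'a set \<Rightarrow> ('a \<Rightarrow> 'a \<Rightarrow> real) \<Rightarrow> 'a topology" where
  "qtopology X \<rho> = topology (\<lambda>U. U \<subseteq> X \<and> (\<forall>x\<in>U. \<exists>r>0. qball X \<rho> x r \<subseteq> U))"

definition qborel_sets :: "'a set \<Rightarrow> ('a \<Rightarrow> 'a \<Rightarrow> real) \<Rightarrow> 'a set set" where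
  "qborel_sets X \<rho> = sigma_sets X {U. openin (qtopology X \<rho>) U}"

definition qsupport :: "'a set \<Rightarrow> ('a \<Rightarrow> 'a \<Rightarrow> real) \<Rightarrow> 'a measure \<Rightarrow> 'a set" where
  "qsupport X \<rho> M = {x \<in> X. \<forall>U. openin (qtopology X \<rho>) U \<and> x \<in> U \<longrightarrow> 0 < emeasure M U}"

text \<open>Since balls need not be Borel, while the measure of every ball has to be defined, the domain
  of the measure is allowed to be any \<open>\<sigma>\<close>-algebra which contains the Borel sets and the balls;
  Borel regularity relates the two. If \<open>sets M\<close> is exactly the Borel \<open>\<sigma>\<close>-algebra, then the
  regularity clause is automatic.\<close>

definition doubling_measure_coeff ::
    "real \<Rightarrow> 'a set \<Rightarrow> ('a \<Rightarrow> 'a \<Rightarrow> real) \<Rightarrow> 'a measure \<Rightarrow> bool" where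
  "doubling_measure_coeff C X \<rho> M \<longleftrightarrow>
     1 \<le> C \<and>
     space M = X \<and> qborel_sets X \<rho> \<subseteq> sets M \<and>
     (\<forall>A\<in>sets M. \<exists>B\<in>qborel_sets X \<rho>. A \<subseteq> B \<and> emeasure M B = emeasure M A) \<and>
     qtopology X \<rho> closure_of qsupport X \<rho> M = X \<and>
     (\<forall>x\<in>X. \<forall>r>0. qball X \<rho> x r \<in> sets M \<and>
        0 < emeasure M (qball X \<rho> x r) \<and> emeasure M (qball X \<rho> x r) < \<infinity>) \<and>
     (\<forall>x\<in>X. \<forall>r>0. emeasure M (qball X \<rho> x (2 * r)) \<le> ennreal C * emeasure M (qball X \<rho> x r))"

definition doubling_measure :: "'a set \<Rightarrow> ('a \<Rightarrow> 'a \<Rightarrow> real) \<Rightarrow> 'a measure \<Rightarrow> bool" where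
  "doubling_measure X \<rho> M \<longleftrightarrow> (\<exists>C. doubling_measure_coeff C X \<rho> M)"

definition flat_space :: "'a set \<Rightarrow> 'a \<Rightarrow> 'a set" where
  "flat_space X c = X - {c}"

definition flat_dist :: "('a \<Rightarrow> 'a \<Rightarrow> real) \<Rightarrow> 'a \<Rightarrow> 'a \<Rightarrow> 'a \<Rightarrow> real" where
  "flat_dist \<rho> c x y = \<rho> x y / (\<rho> x c * \<rho> y c)"

definition flat_measure :: "'a set \<Rightarrow> ('a \<Rightarrow> 'a \<Rightarrow> real) \<Rightarrow> 'a measure \<Rightarrow> 'a \<Rightarrow> 'a measure" where
  "flat_measure X \<rho> M c =
     density (restrict_space M (flat_space X c)) (\<lambda>z. 1 / (emeasure M (qball X \<rho> c (\<rho> c z)))\<^sup>2)"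

text \<open>In the sphericalization, \<open>None\<close> is the added point \<open>\<infinity>\<close>.\<close>

definition sph_space :: "'a set \<Rightarrow> 'a option set" where
  "sph_space X = insert None (Some ` X)"

fun sph_dist :: "('a \<Rightarrow> 'a \<Rightarrow> real) \<Rightarrow> 'a \<Rightarrow> 'a option \<Rightarrow> 'a option \<Rightarrow> real" where
  "sph_dist \<rho> a (Some x) (Some y) = \<rho> x y / ((1 + \<rho> x a) * (1 + \<rho> y a))"
| "sph_dist \<rho> a (Some x) None = 1 / (1 + \<rho> x a)"
| "sph_dist \<rho> a None (Some y) = 1 / (1 + \<rho> y a)"
| "sph_dist \<rho> a None None = 0"

definition sph_measure ::
    "'a set \<Rightarrow> ('a \<Rightarrow> 'a \<Rightarrow> real) \<Rightarrow> 'a measure \<Rightarrow> 'a \<Rightarrow> 'a option measure" where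
  "sph_measure X \<rho> M a =
     distr (density M (\<lambda>z. 1 / (emeasure M (qball X \<rho> a (1 + \<rho> a z)))\<^sup>2))
       (sigma (sph_space X) {A. A \<subseteq> sph_space X \<and> Some -` A \<in> sets M}) Some"

text \<open>The remaining lemmas check that the above constructions have the intended meaning.\<close>

lemma istopology_qtopology:
  "istopology (\<lambda>U. U \<subseteq> X \<and> (\<forall>x\<in>U. \<exists>r>0. qball X \<rho> x r \<subseteq> U))"
  unfolding istopology_def
proof (intro conjI allI impI)
  fix S T assume S: "S \<subseteq> X \<and> (\<forall>x\<in>S. \<exists>r>0. qball X \<rho> x r \<subseteq> S)"
    and T: "T \<subseteq> X \<and> (\<forall>x\<in>T. \<exists>r>0. qball X \<rho> x r \<subseteq> T)"
  show "S \<inter> T \<subseteq> X" using S by blast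
  show "\<forall>x\<in>S \<inter> T. \<exists>r>0. qball X \<rho> x r \<subseteq> S \<inter> T"
  proof
    fix x assume "x \<in> S \<inter> T"
    then obtain r s where "r > 0" "qball X \<rho> x r \<subseteq> S" "s > 0" "qball X \<rho> x s \<subseteq> T"
      using S T by (meson IntD1 IntD2)
    then show "\<exists>r>0. qball X \<rho> x r \<subseteq> S \<inter> T"
      by (intro exI[of _ "min r s"]) (auto simp: qball_def subset_iff)
  qed
next
  fix \<K> assume "\<forall>K\<in>\<K>. K \<subseteq> X \<and> (\<forall>x\<in>K. \<exists>r>0. qball X \<rho> x r \<subseteq> K)"
  then show "\<Union>\<K> \<subseteq> X" and "\<forall>x\<in>\<Union>\<K>. \<exists>r>0. qball X \<rho> x r \<subseteq> \<Union>\<K>"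
    by (blast, meson Union_iff Union_upper order_trans)
qed

lemma openin_qtopology:
  "openin (qtopology X \<rho>) U \<longleftrightarrow> U \<subseteq> X \<and> (\<forall>x\<in>U. \<exists>r>0. qball X \<rho> x r \<subseteq> U)"
  unfolding qtopology_def using istopology_qtopology[of X \<rho>] by simp

lemma topspace_qtopology: "topspace (qtopology X \<rho>) = X"
proof -
  have "openin (qtopology X \<rho>) X"
    unfolding openin_qtopology by (auto simp: qball_def intro: exI[of _ 1])
  then show ?thesis
    by (metis openin_qtopology openin_subset openin_topspace subset_antisym)
qed

lemma borel_measurable_qdist:
  assumes "doubling_measure_coeff C X \<rho> M" "quasi_metric_on K X \<rho>" "c \<in> X"
  shows "\<rho> c \<in> borel_measurable M"
proof (unfold borel_measurable_iff_less, rule allI)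
  fix r
  have sp: "space M = X" and b: "\<And>r. r > 0 \<Longrightarrow> qball X \<rho> c r \<in> sets M"
    using assms unfolding doubling_measure_coeff_def by auto
  have nn: "y \<in> X \<Longrightarrow> 0 \<le> \<rho> c y" for y
    using assms(2,3) unfolding quasi_metric_on_def by simp
  show "{w \<in> space M. \<rho> c w < r} \<in> sets M"
  proof (cases "r > 0")
    case True then show ?thesis using b sp by (simp add: qball_def)
  next
    case False
    then have "{w \<in> space M. \<rho> c w < r} = {}"
      using nn sp by fastforce
    then show ?thesis by (simp only: sets.empty_sets)
  qed
qed

lemma borel_measurable_qball_radius:
  assumes D: "doubling_measure_coeff C X \<rho> M" and Q: "quasi_metric_on K X \<rho>" and c: "c \<in> X"
  shows "(\<lambda>z. emeasure M (qball X \<rho> c (t + \<rho> c z))) \<in> borel_measurable M"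
proof -
  let ?h = "\<lambda>r. enn2real (emeasure M (qball X \<rho> c r))"
  have b: "r > 0 \<Longrightarrow> qball X \<rho> c r \<in> sets M \<and> emeasure M (qball X \<rho> c r) < \<infinity>" for r
    using D c unfolding doubling_measure_coeff_def by auto
  have nn: "y \<in> X \<Longrightarrow> 0 \<le> \<rho> c y" for y
    using Q c unfolding quasi_metric_on_def by simp
  have e: "r \<le> 0 \<Longrightarrow> qball X \<rho> c r = {}" for r
    by (auto simp: qball_def dest: nn)
  have b': "qball X \<rho> c r \<in> sets M \<and> emeasure M (qball X \<rho> c r) < \<infinity>" for r
    using b[of r] e[of r] by (cases "r > 0") auto
  have "mono ?h"
    using b' by (intro monoI enn2real_mono emeasure_mono) (auto simp: qball_def)
  then have [measurable]: "?h \<in> borel_measurable borel" by (rule borel_measurable_mono)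
  have [measurable]: "\<rho> c \<in> borel_measurable M" using borel_measurable_qdist[OF D Q c] .
  have "(\<lambda>z. ennreal (?h (t + \<rho> c z))) \<in> borel_measurable M" by measurable
  then show ?thesis using b' by (simp add: ennreal_enn2real_if less_top[symmetric])
qed

lemma sets_flat_measure:
  assumes "doubling_measure_coeff C X \<rho> M" "quasi_metric_on K X \<rho>" "c \<in> X"
  shows "flat_space X c \<in> sets M"
    and "sets (flat_measure X \<rho> M c) = {A \<in> sets M. A \<subseteq> flat_space X c}"
proof -
  have "openin (qtopology X \<rho>) (X - {c})"
    unfolding openin_qtopology
  proof (intro conjI ballI)
    fix x assume "x \<in> X - {c}"
    then show "\<exists>r>0. qball X \<rho> x r \<subseteq> X - {c}"
      using assms(2,3) unfolding quasi_metric_on_def qball_def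
      by (intro exI[of _ "\<rho> x c"]) (auto simp: less_le)
  qed auto
  then have "X - {c} \<in> qborel_sets X \<rho>" unfolding qborel_sets_def by auto
  then show F: "flat_space X c \<in> sets M"
    using assms(1) unfolding doubling_measure_coeff_def flat_space_def by auto
  have "flat_space X c \<inter> space M \<in> sets M"
    using F by auto
  from sets_restrict_space_iff[OF this]
  show "sets (flat_measure X \<rho> M c) = {A \<in> sets M. A \<subseteq> flat_space X c}"
    unfolding flat_measure_def by auto
qed

lemma emeasure_flat_measure:
  assumes "doubling_measure_coeff C X \<rho> M" "quasi_metric_on K X \<rho>" "c \<in> X"
    and "A \<in> sets M" "A \<subseteq> flat_space X c"
  shows "emeasure (flat_measure X \<rho> M c) A =
    (\<integral>\<^sup>+z\<in>A. 1 / (emeasure M (qball X \<rho> c (\<rho> c z)))\<^sup>2 \<partial>M)"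
proof -
  have [measurable]: "(\<lambda>z. emeasure M (qball X \<rho> c (\<rho> c z))) \<in> borel_measurable M"
    using borel_measurable_qball_radius[OF assms(1-3), of 0] by simp
  have [measurable]: "(\<lambda>z. 1 / (emeasure M (qball X \<rho> c (\<rho> c z)))\<^sup>2) \<in> borel_measurable M"
    by measurable
  have F: "flat_space X c \<inter> space M \<in> sets M"
    using sets_flat_measure(1)[OF assms(1-3)] by auto
  have "A \<in> sets (restrict_space M (flat_space X c))"
    using F assms(4,5) by (simp add: sets_restrict_space_iff)
  then show ?thesis unfolding flat_measure_def using F assms(5)
    by (subst emeasure_density)
      (auto simp: nn_integral_restrict_space measurable_restrict_space1 indicator_def
        intro!: nn_integral_cong)
qed

lemma sets_sph_measure:
  assumes "space M = X"
  shows "sets (sph_measure X \<rho> M a) = {A. A \<subseteq> sph_space X \<and> Some -` A \<in> sets M}"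
proof -
  have "sigma_algebra (sph_space X) {A. A \<subseteq> sph_space X \<and> Some -` A \<in> sets M}"
  proof (subst sigma_algebra_iff2)
    have 1: "Some -` (sph_space X - s) = space M - Some -` s" for s
      using assms by (auto simp: sph_space_def)
    show "{A. A \<subseteq> sph_space X \<and> Some -` A \<in> sets M} \<subseteq> Pow (sph_space X) \<and>
      {} \<in> {A. A \<subseteq> sph_space X \<and> Some -` A \<in> sets M} \<and>
      (\<forall>s\<in>{A. A \<subseteq> sph_space X \<and> Some -` A \<in> sets M}.
         sph_space X - s \<in> {A. A \<subseteq> sph_space X \<and> Some -` A \<in> sets M}) \<and>
      (\<forall>A. range A \<subseteq> {A. A \<subseteq> sph_space X \<and> Some -` A \<in> sets M} \<longrightarrow>
         (\<Union>i::nat. A i) \<in> {A. A \<subseteq> sph_space X \<and> Some -` A \<in> sets M})"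
      using 1 by (auto simp: vimage_UN image_subset_iff intro!: sets.countable_UN'')
  qed
  then show ?thesis
    unfolding sph_measure_def sets_distr by (rule sigma_algebra.sets_measure_of_eq)
qed

lemma emeasure_sph_measure:
  assumes "doubling_measure_coeff C X \<rho> M" "quasi_metric_on K X \<rho>" "a \<in> X"
    and "A \<subseteq> sph_space X" "Some -` A \<in> sets M"
  shows "emeasure (sph_measure X \<rho> M a) A =
    (\<integral>\<^sup>+z\<in>Some -` A. 1 / (emeasure M (qball X \<rho> a (1 + \<rho> a z)))\<^sup>2 \<partial>M)"
proof -
  have sp: "space M = X" using assms(1) unfolding doubling_measure_coeff_def by auto
  have [measurable]: "(\<lambda>z. emeasure M (qball X \<rho> a (1 + \<rho> a z))) \<in> borel_measurable M"
    using borel_measurable_qball_radius[OF assms(1-3)] .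
  have [measurable]: "(\<lambda>z. 1 / (emeasure M (qball X \<rho> a (1 + \<rho> a z)))\<^sup>2) \<in> borel_measurable M"
    by measurable
  let ?S = "sigma (sph_space X) {A. A \<subseteq> sph_space X \<and> Some -` A \<in> sets M}"
  have S: "sets ?S = {A. A \<subseteq> sph_space X \<and> Some -` A \<in> sets M}"
    using sets_sph_measure[OF sp, of \<rho> a] unfolding sph_measure_def by simp
  have m: "Some \<in> M \<rightarrow>\<^sub>M ?S"
    by (rule measurable_measure_of)
      (use sp in \<open>auto simp: sph_space_def intro: sets.Int\<close>)
  have "Some -` A \<inter> space M = Some -` A" using assms(5) sets.sets_into_space by blast
  then show ?thesis
    unfolding sph_measure_def using m assms(4,5) S
    by (simp add: emeasure_distr emeasure_density)
qed

end

theory Submission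
  imports Defs
begin

text \<open>Both constructions are inversions \<open>\<rho> x y / (w x * w y)\<close> with respect to a weight
  \<open>w z = t + \<rho> c z\<close>, where \<open>t = 0\<close> for the flattening and \<open>t = 1\<close> for the sphericalization, and the
  new measure has density \<open>1 / (V (w z))\<^sup>2\<close> with \<open>V s = \<mu> (B(c, s))\<close>. Since \<open>w x \<le> k * max (\<rho> x y) (w y)\<close>,
  a new ball of radius \<open>r\<close> about \<open>x\<close> with \<open>r * w x\<close> small is comparable to an old ball of radius
  \<open>r * (w x)\<^sup>2\<close> on which the density is almost constant, so doubling is inherited from \<open>\<mu>\<close>.
  If \<open>r * w x\<close> is not small, the ball lies in a tail \<open>{z. a / r \<le> w z}\<close>. A tail \<open>{z. s \<le> w z}\<close> has
  new mass \<open>O(1 / V s)\<close>, as one sees by cutting along dyadic levels of \<open>V \<circ> w\<close>. Conversely,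
  a single ball \<open>B(y, \<delta> * w y)\<close> has new mass at least of order \<open>1 / V (w y)\<close>; uniform perfectness is
  used only to find such a ball, with \<open>w y\<close> comparable to \<open>1 / r\<close>, inside the given one.\<close>

section \<open>Doubling measures and transport of Borel sets\<close>

lemma qball_mono: "r \<le> s \<Longrightarrow> qball X \<rho> x r \<subseteq> qball X \<rho> x s"
  by (auto simp: qball_def)

text \<open>An open set contains a ball about each of its points, so positive mass of balls already
  gives full support; a doubling constant may be raised to be at least 1.\<close>

lemma doubling_measureI:
  assumes sp: "space N = Y" and borel: "qborel_sets Y d \<subseteq> sets N"
    and reg: "\<And>A. A \<in> sets N \<Longrightarrow> \<exists>B\<in>qborel_sets Y d. A \<subseteq> B \<and> emeasure N B = emeasure N A"
    and ball: "\<And>x r. x \<in> Y \<Longrightarrow> 0 < r \<Longrightarrow> qball Y d x r \<in> sets N"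
    and pos: "\<And>x r. x \<in> Y \<Longrightarrow> 0 < r \<Longrightarrow> 0 < emeasure N (qball Y d x r)"
    and fin: "\<And>x r. x \<in> Y \<Longrightarrow> 0 < r \<Longrightarrow> emeasure N (qball Y d x r) < \<infinity>"
    and dbl: "\<exists>D. \<forall>x\<in>Y. \<forall>r>0. emeasure N (qball Y d x (2 * r)) \<le> ennreal D * emeasure N (qball Y d x r)"
  shows "doubling_measure Y d N"
proof -
  from dbl obtain D where D:
    "\<And>x r. x \<in> Y \<Longrightarrow> 0 < r \<Longrightarrow> emeasure N (qball Y d x (2 * r)) \<le> ennreal D * emeasure N (qball Y d x r)"
    by blast
  have D1: "emeasure N (qball Y d x (2 * r)) \<le> ennreal (max 1 D) * emeasure N (qball Y d x r)"
    if "x \<in> Y" "0 < r" for x r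
    using D[OF that] by (rule order_trans) (auto intro!: mult_right_mono ennreal_leI)
  have "qsupport Y d N = Y"
  proof -
    have "0 < emeasure N U" if "x \<in> Y" "openin (qtopology Y d) U" "x \<in> U" for x U
    proof -
      have U: "U \<in> sets N"
        using borel that(2) openin_subset[OF that(2)] unfolding qborel_sets_def topspace_qtopology by auto
      from that(2,3) obtain r where "r > 0" "qball Y d x r \<subseteq> U" unfolding openin_qtopology by blast
      then show ?thesis using pos[OF that(1)] emeasure_mono[OF _ U]
        by (meson less_le_trans)
    qed
    then show ?thesis unfolding qsupport_def by auto
  qed
  then have "qtopology Y d closure_of qsupport Y d N = Y"
    using closure_of_topspace[of "qtopology Y d"] by (simp add: topspace_qtopology)
  then have "doubling_measure_coeff (max 1 D) Y d N"
    unfolding doubling_measure_coeff_def using assms(1-6) D1 by auto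
  then show ?thesis unfolding doubling_measure_def by blast
qed

lemma sigma_algebra_qborel: "sigma_algebra X (qborel_sets X \<rho>)"
  unfolding qborel_sets_def
  by (rule sigma_algebra_sigma_sets) (auto simp: openin_qtopology)

lemma inverse_square_antimono: "0 < x \<Longrightarrow> x \<le> y \<Longrightarrow> 1 / y\<^sup>2 \<le> 1 / (x::real)\<^sup>2"
  by (intro frac_le power_mono) auto

text \<open>Preimages commute with complements and countable unions, so it suffices to test open
  sets. This lemma and its image version move Borel sets between the old and the new space;
  complements are taken relative to \<open>Y\<close>, hence \<open>Y\<close> itself has to be
  Borel.\<close>

lemma qborel_sets_vimage_Int:
  assumes "\<And>U. openin (qtopology Z d) U \<Longrightarrow> g -` U \<inter> Y \<in> qborel_sets X \<rho>"
    and Y: "Y \<in> qborel_sets X \<rho>" and g: "g ` Y \<subseteq> Z" and A: "A \<in> qborel_sets Z d"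
  shows "g -` A \<inter> Y \<in> qborel_sets X \<rho>"
proof -
  interpret X: sigma_algebra X "qborel_sets X \<rho>"
    by (rule sigma_algebra_qborel)
  show ?thesis using A unfolding qborel_sets_def[of Z]
  proof induction
    case (Compl A)
    have "g -` (Z - A) \<inter> Y = Y - (g -` A \<inter> Y)" using g by auto
    then show ?case using Compl Y by auto
  next
    case (Union A)
    have "g -` (\<Union>i. A i) \<inter> Y = (\<Union>i. g -` A i \<inter> Y)" by blast
    then show ?case using Union.IH by (simp only: X.countable_UN' X.countable_nat_UN image_subset_iff ball_UNIV UNIV_I simp_thms)
  qed (use assms in auto)
qed

text \<open>Injectivity on \<open>Y\<close> makes images commute with complements taken inside the
  image of \<open>Y\<close>.\<close>

lemma qborel_sets_image_Int:
  assumes "\<And>U. openin (qtopology X \<rho>) U \<Longrightarrow> g ` (U \<inter> Y) \<in> qborel_sets Z d"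
    and Y: "g ` Y \<in> qborel_sets Z d" "inj_on g Y" "Y \<subseteq> X" and A: "A \<in> qborel_sets X \<rho>"
  shows "g ` (A \<inter> Y) \<in> qborel_sets Z d"
proof -
  interpret Z: sigma_algebra Z "qborel_sets Z d"
    by (rule sigma_algebra_qborel)
  show ?thesis using A unfolding qborel_sets_def[of X]
  proof induction
    case (Compl A)
    have "g ` ((X - A) \<inter> Y) = g ` Y - g ` (A \<inter> Y)" using Y by (auto simp: inj_on_def)
    then show ?case using Compl Y by auto
  next
    case (Union A)
    have "g ` ((\<Union>i. A i) \<inter> Y) = (\<Union>i. g ` (A i \<inter> Y))" by auto
    then show ?case using Union by auto
  qed (use assms in auto)
qed

section \<open>The common setting: a weighted inversion\<close>

locale weighted_space =
  fixes X :: "'a set" and \<rho> :: "'a \<Rightarrow> 'a \<Rightarrow> real" and M :: "'a measure"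
    and K \<tau> C t :: real and c :: 'a
  assumes Q: "quasi_metric_on K X \<rho>" and perfect: "uniformly_perfect \<tau> X \<rho>"
    and D: "doubling_measure_coeff C X \<rho> M" and c: "c \<in> X" and t: "0 \<le> t"
begin

text \<open>\<open>W x r\<close> is the ball of the inverted quasi-metric, without the point at infinity, and \<open>m\<close> is
  the mass of the new measure.\<close>

definition w :: "'a \<Rightarrow> real" where "w z = t + \<rho> c z"
definition Y :: "'a set" where "Y = {z \<in> X. 0 < w z}"
definition b :: "'a \<Rightarrow> real \<Rightarrow> real" where "b x r = measure M (qball X \<rho> x r)"
text \<open>One constant for all comparisons: \<open>K\<close> comes from the quasi-triangle
  inequality, the factor 2 from adding \<open>t\<close> and \<open>\<rho> c x\<close>.\<close>

definition k :: real where "k = 2 * K"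
definition m :: "'a set \<Rightarrow> ennreal" where
  "m A = (\<integral>\<^sup>+z\<in>A. 1 / (emeasure M (qball X \<rho> c (w z)))\<^sup>2 \<partial>M)"
definition W :: "'a \<Rightarrow> real \<Rightarrow> 'a set" where
  "W x r = {y \<in> Y. \<rho> x y < r * w x * w y}"

lemma rho: 
  "x \<in> X \<Longrightarrow> y \<in> X \<Longrightarrow> 0 \<le> \<rho> x y"
  "x \<in> X \<Longrightarrow> y \<in> X \<Longrightarrow> \<rho> x y = \<rho> y x"
  "x \<in> X \<Longrightarrow> y \<in> X \<Longrightarrow> \<rho> x y = 0 \<longleftrightarrow> x = y"
  "x \<in> X \<Longrightarrow> y \<in> X \<Longrightarrow> z \<in> X \<Longrightarrow> \<rho> x z \<le> K * max (\<rho> x y) (\<rho> y z)"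
  "1 \<le> K"
  using Q unfolding quasi_metric_on_def by blast+

lemma k: "2 \<le> k" using rho(5) by (simp add: k_def)

lemma C: "1 \<le> C" and space_M: "space M = X" using D unfolding doubling_measure_coeff_def by auto

lemma w_nonneg: "z \<in> X \<Longrightarrow> 0 \<le> w z" and w_ge: "z \<in> X \<Longrightarrow> t \<le> w z"
  and w_ge_rho: "\<rho> c z \<le> w z"
  using rho(1)[OF c] t by (auto simp: w_def)

lemma Y_X: "x \<in> Y \<Longrightarrow> x \<in> X" "x \<in> Y \<Longrightarrow> 0 < w x" by (auto simp: Y_def)

text \<open>Each summand of \<open>w x\<close> is at most \<open>K\<close> times the maximum:
  \<open>\<rho> c x\<close> by a detour through \<open>y\<close>, and \<open>t\<close> because it is
  a lower bound for \<open>w y\<close>.\<close>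

lemma w_le: 
  assumes "x \<in> X" "y \<in> X"
  shows "w x \<le> k * max (\<rho> x y) (w y)"
proof -
  have "\<rho> c x \<le> K * max (\<rho> c y) (\<rho> y x)" using rho(4) c assms by blast
  also have "\<dots> \<le> K * max (\<rho> x y) (w y)"
    using rho(2)[OF assms] rho(5) w_ge_rho[of y] by (intro mult_left_mono) auto
  finally have 1: "\<rho> c x \<le> K * max (\<rho> x y) (w y)" .
  have "t \<le> 1 * max (\<rho> x y) (w y)" using w_ge[OF assms(2)] by simp
  also have "\<dots> \<le> K * max (\<rho> x y) (w y)" 
    using rho(5) rho(1)[OF assms] by (intro mult_right_mono) auto
  finally show ?thesis using 1 by (simp add: w_def k_def)
qed

lemma rho_le:
  assumes "x \<in> X" "y \<in> X"
  shows "\<rho> x y \<le> k * max (w x) (w y)"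
proof -
  have "\<rho> x y \<le> K * max (\<rho> x c) (\<rho> c y)" using rho(4) c assms by blast
  also have "\<dots> \<le> k * max (w x) (w y)"
    using rho(2)[OF assms(1) c] rho(5) w_ge_rho[of x] w_ge_rho[of y] w_nonneg[OF assms(1)]
    by (intro mult_mono) (auto simp: k_def rho(1) assms c max_def)
  finally show ?thesis .
qed

section \<open>Volumes of old balls\<close>

lemma qball_sets: "x \<in> X \<Longrightarrow> qball X \<rho> x r \<in> sets M"
  and emeasure_qball: "x \<in> X \<Longrightarrow> emeasure M (qball X \<rho> x r) = ennreal (b x r)"
proof -
  assume x: "x \<in> X"
  \<comment> \<open>Balls of nonpositive radius are empty, so measurability and finiteness extend to
    every real radius.\<close>
  have "qball X \<rho> x r = {}" if "r \<le> 0" using rho(1)[OF x] that by (force simp: qball_def)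
  then have "qball X \<rho> x r \<in> sets M \<and> emeasure M (qball X \<rho> x r) < \<infinity>"
    using D x unfolding doubling_measure_coeff_def by (cases "r > 0") auto
  then show "qball X \<rho> x r \<in> sets M" "emeasure M (qball X \<rho> x r) = ennreal (b x r)"
    by (auto simp: b_def emeasure_eq_ennreal_measure)
qed

lemma b_nonneg: "0 \<le> b x r" by (simp add: b_def)

lemma b_pos: "x \<in> X \<Longrightarrow> 0 < r \<Longrightarrow> 0 < b x r"
  using D emeasure_qball[of x r] unfolding doubling_measure_coeff_def
  by (metis ennreal_less_zero_iff)

lemma b_subset: "x \<in> X \<Longrightarrow> y \<in> X \<Longrightarrow> qball X \<rho> x r \<subseteq> qball X \<rho> y s \<Longrightarrow> b x r \<le> b y s"
  using emeasure_mono[of "qball X \<rho> x r" "qball X \<rho> y s" M] qball_sets[of y s]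
  by (simp add: emeasure_qball b_nonneg)

lemma b_mono: "x \<in> X \<Longrightarrow> r \<le> s \<Longrightarrow> b x r \<le> b x s"
  by (rule b_subset) (auto simp: qball_mono)

lemma b_double: 
  assumes "x \<in> X" "0 < r" shows "b x (2 * r) \<le> C * b x r"
proof -
  have "ennreal (b x (2 * r)) \<le> ennreal C * ennreal (b x r)"
    using D assms emeasure_qball unfolding doubling_measure_coeff_def by metis
  then show ?thesis using C b_nonneg by (simp add: ennreal_mult[symmetric])
qed

text \<open>A power of 2 above \<open>A\<close> depends on \<open>A\<close> only, so one constant
  serves all centres and radii.\<close>

lemma b_double_iter:
  "\<exists>E\<ge>1. \<forall>x\<in>X. \<forall>r>0. b x (A * r) \<le> E * b x r"
proof -
  obtain n where n: "A < 2 ^ n" using real_arch_pow[of 2 A] by auto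
  have 1: "b x (2 ^ n * r) \<le> C ^ n * b x r" if "x \<in> X" "0 < r" for x r n
  proof (induction n)
    case (Suc n)
    have "b x (2 ^ Suc n * r) \<le> C * b x (2 ^ n * r)"
      using b_double[OF that(1), of "2 ^ n * r"] that(2) by (simp add: mult.assoc)
    also have "\<dots> \<le> C * (C ^ n * b x r)" using Suc C by (intro mult_left_mono) auto
    finally show ?case by (simp add: mult.assoc)
  qed simp
  have "b x (A * r) \<le> C ^ n * b x r" if "x \<in> X" "0 < r" for x r
    using n that by (intro order_trans[OF b_mono 1]) auto
  then show ?thesis using C by (intro exI[of _ "C ^ n"]) auto
qed

section \<open>The new mass, its density and its tails\<close>

lemma measurable_w [measurable]: "w \<in> borel_measurable M"
  using borel_measurable_qdist[OF D Q c] unfolding w_def by measurable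

lemma measurable_b [measurable]: "(\<lambda>z. b c (w z)) \<in> borel_measurable M"
  using borel_measurable_qball_radius[OF D Q c, of t]
  unfolding b_def measure_def w_def by measurable

lemma sets_W: 
  assumes "x \<in> Y" shows "W x r \<in> sets M"
proof -
  have [measurable]: "\<rho> x \<in> borel_measurable M"
    using borel_measurable_qdist[OF D Q] assms Y_X by blast
  have "W x r = {z\<in>space M. 0 < w z \<and> \<rho> x z < r * w x * w z}"
    unfolding W_def Y_def space_M by auto
  also have "\<dots> \<in> sets M" by measurable
  finally show ?thesis .
qed

lemma density_eq:
  assumes "0 < w z"
  shows "1 / (emeasure M (qball X \<rho> c (w z)))\<^sup>2 = ennreal (1 / (b c (w z))\<^sup>2)"
  using b_pos[OF c assms]
  by (simp add: emeasure_qball[OF c] ennreal_power flip: divide_ennreal)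

lemma m_eq:
  assumes "A \<subseteq> Y"
  shows "m A = (\<integral>\<^sup>+z\<in>A. ennreal (1 / (b c (w z))\<^sup>2) \<partial>M)"
  unfolding m_def using assms
  by (intro nn_integral_cong) (auto simp: indicator_def density_eq Y_def)

lemma m_mono: "A \<subseteq> B \<Longrightarrow> m A \<le> m B"
  unfolding m_def by (intro nn_integral_mono) (auto simp: indicator_def)

text \<open>The density decreases as \<open>w\<close> grows, so a lower bound for \<open>w\<close>
  on \<open>A\<close> bounds it by its value at that level; \<open>m_ge\<close> is the counterpart
  for an upper bound.\<close>

lemma m_le:
  assumes "A \<in> sets M" "0 < s" "\<And>z. z \<in> A \<Longrightarrow> s \<le> w z"
  shows "m A \<le> ennreal (1 / (b c s)\<^sup>2) * emeasure M A"
proof -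
  have AY: "A \<subseteq> Y" using assms sets.sets_into_space[OF assms(1)] by (force simp: Y_def space_M)
  have "m A \<le> (\<integral>\<^sup>+z\<in>A. ennreal (1 / (b c s)\<^sup>2) \<partial>M)"
    unfolding m_eq[OF AY]
    using b_mono[OF c assms(3)] b_pos[OF c assms(2)]
    by (intro nn_integral_mono) 
       (auto simp: indicator_def intro!: ennreal_leI inverse_square_antimono)
  also have "\<dots> = ennreal (1 / (b c s)\<^sup>2) * emeasure M A"
    using assms(1) by (simp add: nn_integral_cmult_indicator)
  finally show ?thesis .
qed

lemma m_ge:
  assumes "A \<in> sets M" "A \<subseteq> Y" "\<And>z. z \<in> A \<Longrightarrow> w z \<le> s"
  shows "ennreal (1 / (b c s)\<^sup>2) * emeasure M A \<le> m A"
proof -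
  have "ennreal (1 / (b c s)\<^sup>2) * emeasure M A = (\<integral>\<^sup>+z\<in>A. ennreal (1 / (b c s)\<^sup>2) \<partial>M)"
    using assms(1) by (simp add: nn_integral_cmult_indicator)
  also have "\<dots> \<le> m A"
    unfolding m_eq[OF assms(2)]
    using b_mono[OF c assms(3)] b_pos[OF c] assms(2)
    by (intro nn_integral_mono) 
       (auto simp: indicator_def Y_def intro!: ennreal_leI inverse_square_antimono)
  finally show ?thesis .
qed

text \<open>Pick a point \<open>z\<close> of the set at which \<open>w\<close> exceeds half its
  supremum. The set then lies in the ball of radius \<open>2 * w z\<close> about \<open>c\<close>,
  whose volume is at most \<open>C * b c (w z)\<close>, hence at most \<open>C * T\<close>.\<close>

lemma emeasure_level_le:
  "emeasure M {z \<in> Y. b c (w z) < T} \<le> ennreal (C * T)"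
proof -
  \<comment> \<open>\<open>w\<close> may be unbounded on the level set, so the supremum is taken on
    truncations, which exhaust the set increasingly.\<close>
  define S where "S n = {z \<in> Y. b c (w z) < T \<and> w z \<le> real n}" for n
  have S: "S n \<in> sets M" for n
  proof -
    have "S n = {z\<in>space M. 0 < w z \<and> b c (w z) < T \<and> w z \<le> real n}"
      unfolding S_def Y_def space_M by auto
    also have "\<dots> \<in> sets M" by measurable
    finally show ?thesis .
  qed
  have le: "emeasure M (S n) \<le> ennreal (C * T)" for n
  proof (cases "S n = {}")
    case False
    then obtain z0 where z0: "z0 \<in> S n" by blast
    have bdd: "bdd_above (w ` S n)" by (rule bdd_aboveI2[of _ _ "real n"]) (auto simp: S_def)
    have "0 < w z0" using z0 by (auto simp: S_def Y_def)
    also have "w z0 \<le> Sup (w ` S n)" using z0 bdd by (intro cSUP_upper) auto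
    finally have "Sup (w ` S n) / 2 < Sup (w ` S n)" by simp
    then obtain z where z: "z \<in> S n" "Sup (w ` S n) / 2 < w z"
      using less_cSUP_iff[of "S n" w] bdd False by blast
    have "S n \<subseteq> qball X \<rho> c (2 * w z)"
    proof
      fix y assume y: "y \<in> S n"
      have "w y \<le> Sup (w ` S n)" using y bdd by (intro cSUP_upper) auto
      then have "\<rho> c y < 2 * w z" using z(2) w_ge_rho[of y] by simp
      then show "y \<in> qball X \<rho> c (2 * w z)" using y by (auto simp: S_def Y_def qball_def)
    qed
    then have "emeasure M (S n) \<le> ennreal (b c (2 * w z))"
      using emeasure_mono[OF _ qball_sets[OF c]] emeasure_qball[OF c] by metis
    also have "\<dots> \<le> ennreal (C * T)"
    proof (rule ennreal_leI)
      have "b c (2 * w z) \<le> C * b c (w z)" using z by (intro b_double c) (auto simp: S_def Y_def)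
      also have "\<dots> \<le> C * T" using z C by (intro mult_left_mono) (auto simp: S_def)
      finally show "b c (2 * w z) \<le> C * T" .
    qed
    finally show ?thesis .
  qed simp
  have "{z \<in> Y. b c (w z) < T} = (\<Union>n. S n)"
    unfolding S_def using real_arch_simple by auto
  moreover have "incseq S" unfolding S_def incseq_def by (auto intro: order_trans)
  ultimately show ?thesis
    using SUP_emeasure_incseq[of S M] S SUP_least[of UNIV "\<lambda>n. emeasure M (S n)", OF le]
    by (simp add: image_subset_iff)
qed

text \<open>With \<open>v = b c s\<close>: where \<open>b c (w z)\<close> lies between
  \<open>2 ^ n * v\<close> and \<open>2 ^ Suc n * v\<close>, the density is at most
  \<open>1 / (2 ^ n * v)\<^sup>2\<close>, while the old measure is at most
  \<open>C * (2 ^ Suc n * v)\<close>. The layers thus contribute a geometric series of ratio 1/2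
  with sum \<open>4 * C / v\<close>.\<close>

lemma m_tail_le:
  assumes "0 < s"
  shows "m {z \<in> X. s \<le> w z} \<le> ennreal (4 * C / b c s)"
proof -
  define v where "v = b c s"
  have v: "0 < v" using b_pos[OF c assms] by (simp add: v_def)
  define S where "S n = {z \<in> Y. b c (w z) < 2 ^ Suc n * v}" for n
  have S: "S n \<in> sets M" for n
  proof -
    have "S n = {z\<in>space M. 0 < w z \<and> b c (w z) < 2 ^ Suc n * v}"
      unfolding S_def Y_def space_M by auto
    also have "\<dots> \<in> sets M" by measurable
    finally show ?thesis .
  qed
  let ?A = "{z \<in> X. s \<le> w z}"
  have AY: "?A \<subseteq> Y" using assms by (auto simp: Y_def)
  have point: "ennreal (1 / (b c (w z))\<^sup>2) * indicator ?A z
      \<le> (\<Sum>n. ennreal (1 / (2 ^ n * v)\<^sup>2) * indicator (S n) z)" for z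
  proof (cases "z \<in> ?A")
    case True
    have bv: "v \<le> b c (w z)" unfolding v_def using True by (intro b_mono c) auto
    define P where "P n \<longleftrightarrow> b c (w z) < 2 ^ Suc n * v" for n
    obtain n where "b c (w z) / v < 2 ^ n" using real_arch_pow[of 2 "b c (w z) / v"] by auto
    also have "(2::real) ^ n \<le> 2 ^ Suc n" by simp
    finally have "P n" unfolding P_def using v by (simp add: field_simps)
    \<comment> \<open>The sets \<open>S n\<close> are nested sublevel sets, but a single term of the
      sum suffices: minimality of \<open>j\<close>, or \<open>bv\<close> when \<open>j = 0\<close>,
      gives \<open>2 ^ j * v \<le> b c (w z)\<close>.\<close>
    define j where "j = (LEAST n. P n)"
    have Pj: "P j" unfolding j_def using \<open>P n\<close> by (rule LeastI)
    have "2 ^ j * v \<le> b c (w z)"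
    proof (cases j)
      case 0 then show ?thesis using bv by simp
    next
      case (Suc i)
      then have "\<not> P i" using not_less_Least[of i P] by (auto simp: j_def)
      then show ?thesis unfolding P_def Suc by simp
    qed
    then have "ennreal (1 / (b c (w z))\<^sup>2) * indicator ?A z \<le> ennreal (1 / (2 ^ j * v)\<^sup>2) * indicator (S j) z"
      using True Pj AY v unfolding P_def S_def
      by (auto simp: subset_iff intro!: ennreal_leI inverse_square_antimono)
    also have "\<dots> \<le> (\<Sum>n. ennreal (1 / (2 ^ n * v)\<^sup>2) * indicator (S n) z)"
      using sum_le_suminf[of "\<lambda>n. ennreal (1 / (2 ^ n * v)\<^sup>2) * indicator (S n) z" "{j}"]
      by (simp only: sum.insert sum.empty finite.intros summableI simp_thms zero_le add_0_right empty_iff)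
    finally show ?thesis .
  qed simp
  have "m ?A \<le> (\<integral>\<^sup>+z. (\<Sum>n. ennreal (1 / (2 ^ n * v)\<^sup>2) * indicator (S n) z) \<partial>M)"
    unfolding m_eq[OF AY] by (intro nn_integral_mono point)
  also have "\<dots> = (\<Sum>n. ennreal (1 / (2 ^ n * v)\<^sup>2) * emeasure M (S n))"
    using S by (subst nn_integral_suminf) (auto simp: nn_integral_cmult_indicator)
  also have "\<dots> \<le> (\<Sum>n. ennreal (2 * C / v * (1 / 2) ^ n))"
  proof (intro suminf_le allI)
    fix n
    have "ennreal (1 / (2 ^ n * v)\<^sup>2) * emeasure M (S n)
        \<le> ennreal (1 / (2 ^ n * v)\<^sup>2) * ennreal (C * (2 ^ Suc n * v))"
      unfolding S_def using v by (intro mult_left_mono emeasure_level_le) auto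
    also have "\<dots> = ennreal (2 * C / v * (1 / 2) ^ n)"
      using v C by (subst ennreal_mult[symmetric]) (auto simp: field_simps power2_eq_square)
    finally show "ennreal (1 / (2 ^ n * v)\<^sup>2) * emeasure M (S n) \<le> \<dots>" .
  qed auto
  also have "\<dots> = ennreal (4 * C / v)"
  proof (rule suminf_ennreal_eq)
    show "0 \<le> 2 * C / v * (1 / 2) ^ n" for n using v C by simp
    show "(\<lambda>n. 2 * C / v * (1 / 2) ^ n) sums (4 * C / v)"
      using sums_mult[OF geometric_sums[of "1/2::real"], of "2 * C / v"] by simp
  qed
  finally show ?thesis by (simp add: v_def)
qed


section \<open>Comparison of old and new balls\<close>

lemma near:
  assumes "x \<in> Y" "z \<in> X" "\<rho> x z < \<delta> * w x" "\<delta> * k \<le> 1"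
  shows "w x \<le> k * w z" "w z \<le> k * w x" "z \<in> Y"
proof -
  have x: "x \<in> X" "0 < w x" using assms(1) by (auto simp: Y_def)
  \<comment> \<open>Smallness of \<open>\<delta>\<close> keeps \<open>\<rho> x z\<close> so far
    below \<open>w x\<close> that the distance drops out of the maximum in both uses of
    \<open>w_le\<close>.\<close>
  have "k * \<rho> x z < (\<delta> * k) * w x" using assms(3) k by (simp add: mult.commute mult.left_commute)
  also have "\<dots> \<le> 1 * w x" using assms(4) x by (intro mult_right_mono) auto
  finally have 1: "k * \<rho> x z < w x" by simp
  then show 2: "w x \<le> k * w z" using w_le[OF x(1) assms(2)] by (auto simp: max_def split: if_splits)
  have "0 < k * w z" using 2 x by linarith
  then show "z \<in> Y" using assms(2) k by (auto simp: Y_def zero_less_mult_iff)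
  have "1 * \<rho> x z \<le> k * \<rho> x z" using k rho(1)[OF x(1) assms(2)] by (intro mult_right_mono) auto
  then have "\<rho> z x < w x" using 1 rho(2)[OF x(1) assms(2)] by simp
  then show "w z \<le> k * w x" using w_le[OF assms(2) x(1)] by (auto simp: max_def split: if_splits)
qed

lemma m_qball_ge:
  assumes "x \<in> Y" "\<delta> * k \<le> 1"
  shows "ennreal (b x (\<delta> * w x) / (b c (k * w x))\<^sup>2) \<le> m (qball X \<rho> x (\<delta> * w x))"
proof -
  let ?B = "qball X \<rho> x (\<delta> * w x)"
  have B: "z \<in> Y \<and> w z \<le> k * w x" if "z \<in> ?B" for z
    using near[OF assms(1) _ _ assms(2), of z] that by (auto simp: qball_def)
  have "ennreal (1 / (b c (k * w x))\<^sup>2) * emeasure M ?B \<le> m ?B"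
    using B assms(1) by (intro m_ge qball_sets) (auto simp: Y_def)
  then show ?thesis
    using assms(1) by (simp add: emeasure_qball Y_X b_nonneg ennreal_mult[symmetric])
qed

lemma m_qball_pos:
  assumes "x \<in> Y" "0 < \<delta>" "\<delta> * k \<le> 1"
  shows "0 < m (qball X \<rho> x (\<delta> * w x))"
proof -
  have "0 < b x (\<delta> * w x) / (b c (k * w x))\<^sup>2"
    using assms k by (intro divide_pos_pos zero_less_power b_pos c) (auto simp: Y_def)
  then show ?thesis
    using m_qball_ge[OF assms(1,3)] by (meson ennreal_less_zero_iff less_le_trans)
qed

text \<open>The condition defining \<open>W\<close> involves the weight of the other point; on the
  old ball that weight is at least \<open>w x / k\<close>, a loss which
  \<open>\<delta> * k \<le> r * w x\<close> absorbs.\<close>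

lemma qball_subset_W:
  assumes "x \<in> Y" "\<delta> * k \<le> 1" "\<delta> * k \<le> r * w x" "0 < \<delta>"
  shows "qball X \<rho> x (\<delta> * w x) \<subseteq> W x r"
proof
  fix z assume "z \<in> qball X \<rho> x (\<delta> * w x)"
  then have z: "z \<in> X" "\<rho> x z < \<delta> * w x" by (auto simp: qball_def)
  note n = near[OF assms(1) z assms(2)]
  have "\<delta> * w x \<le> \<delta> * (k * w z)" using n assms(4) by (intro mult_left_mono) auto
  also have "\<dots> \<le> r * w x * w z" 
    using assms(3) n(3) by (auto simp: Y_def mult.assoc[symmetric] intro!: mult_right_mono)
  finally show "z \<in> W x r" using z n by (auto simp: W_def)
qed

text \<open>Small regime: \<open>k * \<rho> x z < w z\<close>, so the weights of \<open>x\<close>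
  and \<open>z\<close> are comparable and the new ball sits in an old ball of radius of order
  \<open>r * (w x)\<^sup>2\<close>.\<close>

lemma W_small:
  assumes "x \<in> Y" "z \<in> W x r" "k * (r * w x) \<le> 1" "0 < r"
  shows "w x \<le> k * w z" "\<rho> x z < r * w x * (k * w x)"
proof -
  have x: "x \<in> X" "0 < w x" and z: "z \<in> X" "0 < w z" "\<rho> x z < r * w x * w z"
    using assms by (auto simp: Y_def W_def)
  have "k * \<rho> x z < k * (r * w x * w z)" using z k by (intro mult_strict_left_mono) auto
  also have "\<dots> = k * (r * w x) * w z" by simp
  also have "\<dots> \<le> 1 * w z" using assms(3) z by (intro mult_right_mono) auto
  finally have 1: "k * \<rho> x z < w z" by simp
  have "1 * \<rho> x z \<le> k * \<rho> x z" using k rho(1)[OF x(1) z(1)] by (intro mult_right_mono) auto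
  then have "\<rho> x z < w z" using 1 by simp
  then show "w x \<le> k * w z" using w_le[OF x(1) z(1)] by (auto simp: max_def split: if_splits)
  have "w z \<le> k * w x" using 1 w_le[OF z(1) x(1)] rho(2)[OF x(1) z(1)]
    by (auto simp: max_def split: if_splits)
  then have "r * w x * w z \<le> r * w x * (k * w x)" using assms(4) x by (intro mult_left_mono) auto
  then show "\<rho> x z < r * w x * (k * w x)" using z by linarith
qed

text \<open>If \<open>w x \<le> k * w z\<close>, the lower bound on \<open>r * w x\<close> passes on
  to \<open>r * w z\<close>. Otherwise \<open>w_le\<close> gives
  \<open>w x \<le> k * \<rho> x z\<close>, and \<open>w x\<close> cancels after inserting the
  inequality that defines \<open>W\<close>.\<close>

lemma W_big:
  assumes "x \<in> Y" "z \<in> W x r" "1 < k * (r * w x)" "0 < r"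
  shows "1 / (k\<^sup>2 * r) \<le> w z"
proof -
  have x: "x \<in> X" "0 < w x" and z: "z \<in> X" "0 < w z" "\<rho> x z < r * w x * w z"
    using assms by (auto simp: Y_def W_def)
  have "1 \<le> k\<^sup>2 * r * w z"
  proof (cases "w x \<le> k * w z")
    case True
    have "1 < k * (r * w x)" by fact
    also have "\<dots> \<le> k * (r * (k * w z))" using True k assms(4) by (intro mult_left_mono) auto
    finally show ?thesis by (simp add: power2_eq_square mult_ac)
  next
    case False
    then have "w x \<le> k * \<rho> x z" using w_le[OF x(1) z(1)] by (auto simp: max_def split: if_splits)
    also have "\<dots> \<le> k * (r * w x * w z)" using z k by (intro mult_left_mono) auto
    also have "\<dots> = (k * r * w z) * w x" by simp
    finally have 1: "1 \<le> k * r * w z" using x by simp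
    also have "\<dots> \<le> k * (k * r * w z)"
      using k z assms(4) mult_right_mono[of 1 k "k * r * w z"] by simp
    finally show ?thesis by (simp add: power2_eq_square mult_ac)
  qed
  then show ?thesis using k assms(4) by (simp add: field_simps)
qed

section \<open>Uniform perfectness and the doubling estimates\<close>

lemma tau: "0 < \<tau>" "\<tau> < 1" using perfect by (auto simp: uniformly_perfect_def)

text \<open>Supplies a point whose weight is comparable to a prescribed level. The alternative
  \<open>w y = t\<close> covers levels up to the least weight \<open>t\<close>, for which
  \<open>c\<close> is the witness.\<close>

lemma exists_scale:
  assumes "0 < s" "x \<in> X" "s \<le> w x"
  shows "\<exists>y\<in>Y. \<tau> * s \<le> w y \<and> (w y \<le> s \<or> w y = t)"
proof (cases "s \<le> t")
  case True
  have "w c = t" using rho(3)[OF c c] by (simp add: w_def)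
  moreover have "\<tau> * s \<le> t" using tau assms(1) True mult_right_mono[of \<tau> 1 s] by linarith
  ultimately show ?thesis using True assms(1) c by (intro bexI[of _ c]) (auto simp: Y_def)
next
  case False
  \<comment> \<open>Since \<open>w z = t + \<rho> c z\<close>, the level \<open>s\<close>
    corresponds to the radius \<open>s - t\<close>; \<open>x\<close> lies outside this ball, so
    uniform perfectness provides a point in the annulus.\<close>
  have "X - qball X \<rho> c (s - t) \<noteq> {}" using assms by (auto simp: qball_def w_def intro!: exI[of _ x])
  then have "qball X \<rho> c (s - t) - qball X \<rho> c (\<tau> * (s - t)) \<noteq> {}"
    using perfect c False unfolding uniformly_perfect_def by auto
  then obtain y where y: "y \<in> X" "\<rho> c y < s - t" "\<tau> * (s - t) \<le> \<rho> c y"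
    by (force simp: qball_def)
  have "\<tau> * t \<le> t" using tau t by (simp add: mult_left_le_one_le)
  then have 1: "\<tau> * s \<le> w y" using y by (simp add: w_def algebra_simps)
  have "0 < w y" using 1 tau assms(1) by (meson less_le_trans mult_pos_pos)
  then show ?thesis using 1 y by (intro bexI[of _ y]) (auto simp: w_def Y_def)
qed

text \<open>Both masses are of the order \<open>1 / b c (w y)\<close>: \<open>m_tail_le\<close>
  bounds the tail from above, \<open>m_qball_ge\<close> the ball from below. Doubling compares the
  volumes involved: \<open>E1\<close> handles the level \<open>w y / A\<close>, \<open>E2\<close>
  the enlargement by \<open>k\<close>, and \<open>E3\<close> the passage from centre
  \<open>c\<close> to centre \<open>y\<close>.\<close>

lemma tail_le_qball:
  assumes "0 < A" "0 < \<delta>" "\<delta> * k \<le> 1"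
  shows "\<exists>E\<ge>0. \<forall>y\<in>Y. m {z \<in> X. w y / A \<le> w z} \<le> ennreal E * m (qball X \<rho> y (\<delta> * w y))"
proof -
  obtain E1 where E1: "E1 \<ge> 1" "\<And>x r. x \<in> X \<Longrightarrow> 0 < r \<Longrightarrow> b x (A * r) \<le> E1 * b x r"
    using b_double_iter[of A] by blast
  obtain E2 where E2: "E2 \<ge> 1" "\<And>x r. x \<in> X \<Longrightarrow> 0 < r \<Longrightarrow> b x (k * r) \<le> E2 * b x r"
    using b_double_iter[of k] by blast
  obtain E3 where E3: "E3 \<ge> 1" "\<And>x r. x \<in> X \<Longrightarrow> 0 < r \<Longrightarrow> b x (2 * k / \<delta> * r) \<le> E3 * b x r"
    using b_double_iter[of "2 * k / \<delta>"] by blast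
  define E where "E = 4 * C * E1 * E2\<^sup>2 * E3"
  have "m {z \<in> X. w y / A \<le> w z} \<le> ennreal E * m (qball X \<rho> y (\<delta> * w y))" if y: "y \<in> Y" for y
  proof -
    have wy: "0 < w y" "y \<in> X" using y by (auto simp: Y_def)
    define v where "v = b c (w y)"
    have v: "0 < v" using wy by (simp add: v_def b_pos c)
    have p: "0 < b c (w y / A)" "0 < b c (k * w y)" "0 < b y (\<delta> * w y)"
      using wy assms k by (auto intro!: b_pos c)
    have v1: "v \<le> E1 * b c (w y / A)" using E1(2)[OF c, of "w y / A"] wy assms by (simp add: v_def)
    have v2: "b c (k * w y) \<le> E2 * v" using E2(2)[OF c] wy by (simp add: v_def)
    have "v \<le> b y (2 * k * w y)"
      unfolding v_def
    proof (rule b_subset[OF c wy(2)], rule subsetI)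
      fix z assume z: "z \<in> qball X \<rho> c (w y)"
      then have "\<rho> y z \<le> K * max (\<rho> y c) (\<rho> c z)" using rho(4) wy(2) c by (auto simp: qball_def)
      also have "\<dots> \<le> K * w y" 
        using z rho(2,5) wy c w_ge_rho[of y] by (intro mult_left_mono) (auto simp: qball_def)
      also have "\<dots> < 2 * k * w y" using wy rho(5) by (simp add: k_def)
      finally show "z \<in> qball X \<rho> y (2 * k * w y)" using z by (auto simp: qball_def)
    qed
    also have "\<dots> \<le> E3 * b y (\<delta> * w y)" using E3(2)[OF wy(2), of "\<delta> * w y"] assms wy by (simp add: mult.assoc)
    finally have v3: "v \<le> E3 * b y (\<delta> * w y)" .
    have "m {z \<in> X. w y / A \<le> w z} \<le> ennreal (4 * C / b c (w y / A))"
      using wy assms by (intro m_tail_le) auto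
    also have "\<dots> \<le> ennreal (E * (b y (\<delta> * w y) / (b c (k * w y))\<^sup>2))"
    proof (rule ennreal_leI)
      have "4 * C / b c (w y / A) \<le> 4 * C * (E1 / v)"
        using v1 v p C by (simp add: field_simps)
      also have "\<dots> = 4 * C * E1 * E2\<^sup>2 * (v / (E2 * v)\<^sup>2)"
        using v E2 by (simp add: field_simps power2_eq_square)
      also have "\<dots> \<le> 4 * C * E1 * E2\<^sup>2 * (E3 * b y (\<delta> * w y) / (b c (k * w y))\<^sup>2)"
        using v1 v2 v3 v p C E1 E2 E3 by (intro mult_left_mono frac_le power_mono) auto
      finally show "4 * C / b c (w y / A) \<le> E * (b y (\<delta> * w y) / (b c (k * w y))\<^sup>2)"
        by (simp add: E_def)
    qed
    also have "\<dots> = ennreal E * ennreal (b y (\<delta> * w y) / (b c (k * w y))\<^sup>2)"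
      using C E1 E3 by (intro ennreal_mult) (auto simp: E_def b_nonneg)
    also have "\<dots> \<le> ennreal E * m (qball X \<rho> y (\<delta> * w y))"
      using m_qball_ge[OF y assms(3)] by (intro mult_left_mono) auto
    finally show ?thesis .
  qed
  then show ?thesis using C E1 E3 by (intro exI[of _ E]) (auto simp: E_def)
qed

text \<open>A ball about a point \<open>y\<close> of suitable weight mediates: it lies in the
  smaller tail, and by \<open>tail_le_qball\<close> its mass controls the larger one. The assumption
  on \<open>x\<close> says that the weights reach far enough to find \<open>y\<close>.\<close>

lemma tail_doubling:
  assumes "1 \<le> l"
  shows "\<exists>E\<ge>0. \<forall>s>0. (\<exists>x\<in>X. 2 * k * l / \<tau> * s \<le> w x) \<longrightarrow>
    m {z \<in> X. s / l \<le> w z} \<le> ennreal E * m {z \<in> X. l * s < w z}"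
proof -
  \<comment> \<open>Chosen so that \<open>\<tau> * L = 2 * k * l\<close>: if \<open>w y\<close> is
    at least \<open>\<tau> * (L * s)\<close>, then weights are at least \<open>2 * l * s\<close> on
    the ball of radius \<open>w y / k\<close> about \<open>y\<close>. The factor 2 yields the strict
    inequality.\<close>
  define L where "L = 2 * k * l / \<tau>"
  have L: "1 \<le> L" "0 < L" "\<tau> * L = 2 * k * l"
  proof -
    show "0 < L" "\<tau> * L = 2 * k * l" using k assms tau by (auto simp: L_def)
    have "\<tau> * 1 \<le> k * l" using tau k assms mult_mono[of 1 k 1 l] by simp
    then have "\<tau> \<le> 2 * k * l" using k assms tau by simp
    then show "1 \<le> L" using tau by (simp add: L_def)
  qed
  have d: "0 < 1 / k" "1 / k * k \<le> 1" using k by auto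
  obtain E where E: "E \<ge> 0" "\<And>y. y \<in> Y \<Longrightarrow> 
      m {z \<in> X. w y / (L * l) \<le> w z} \<le> ennreal E * m (qball X \<rho> y (1 / k * w y))"
    using tail_le_qball[of "L * l", OF _ d] L assms by auto
  have "m {z \<in> X. s / l \<le> w z} \<le> ennreal E * m {z \<in> X. l * s < w z}"
    if s: "0 < s" and x: "x \<in> X" "L * s \<le> w x" for s x
  proof -
    obtain y where y: "y \<in> Y" "\<tau> * (L * s) \<le> w y" "w y \<le> L * s \<or> w y = t"
      using exists_scale[OF _ x] s L by auto
    have wy: "0 < w y" using y by (simp add: Y_def)
    have ll: "1 * 1 \<le> L * l" using L assms by (intro mult_mono) auto
    have "{z \<in> X. s / l \<le> w z} \<subseteq> {z \<in> X. w y / (L * l) \<le> w z}"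
    proof (intro Collect_mono impI conjI)
      fix z assume z: "z \<in> X \<and> s / l \<le> w z"
      then show "z \<in> X" by blast
      show "w y / (L * l) \<le> w z"
        using y(3)
      proof
        assume "w y \<le> L * s"
        then have "w y / (L * l) \<le> L * s / (L * l)" using L assms by (intro divide_right_mono) auto
        also have "\<dots> = s / l" using L by simp
        finally show ?thesis using z by linarith
      next
        \<comment> \<open>The value \<open>t\<close> is a lower bound for all weights, so the tail
          at level \<open>w y / (L * l)\<close> is all of \<open>X\<close>.\<close>
        assume t: "w y = t"
        have "w y / (L * l) \<le> w y / 1" using ll wy by (intro divide_left_mono) auto
        then show ?thesis using t w_ge[of z] z by simp
      qed
    qed
    then have "m {z \<in> X. s / l \<le> w z} \<le> m {z \<in> X. w y / (L * l) \<le> w z}" by (rule m_mono)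
    also have "\<dots> \<le> ennreal E * m (qball X \<rho> y (1 / k * w y))" using E(2) y(1) .
    also have "\<dots> \<le> ennreal E * m {z \<in> X. l * s < w z}"
    proof (intro mult_left_mono m_mono subsetI)
      fix z assume "z \<in> qball X \<rho> y (1 / k * w y)"
      then have z: "z \<in> X" "w y \<le> k * w z"
        using near[OF y(1) _ _ d(2), of z] by (auto simp: qball_def)
      have "k * (2 * l * s) = \<tau> * (L * s)" using L(3) by (simp add: mult.assoc[symmetric])
      then have "k * (2 * l * s) \<le> k * w z" using y(2) z by linarith
      then have "2 * l * s \<le> w z" using k by simp
      moreover have "0 < l * s" using s assms by simp
      ultimately show "z \<in> {z \<in> X. l * s < w z}" using z by auto
    qed auto
    finally show ?thesis .
  qed
  then show ?thesis using E(1) unfolding L_def by blast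
qed

text \<open>Three regimes. For small \<open>r * w x\<close> both balls are compared with old balls
  about \<open>x\<close>. Otherwise \<open>W x (2 * r)\<close> lies in a tail at a level of order
  \<open>1 / r\<close>: if \<open>w x\<close> is far above \<open>1 / r\<close>, then
  \<open>W x r\<close> contains a tail and \<open>tail_doubling\<close> applies; if
  \<open>w x\<close> is comparable to \<open>1 / r\<close>, an old ball about \<open>x\<close>
  inside \<open>W x r\<close> controls the tail.\<close>

lemma W_doubling:
  "\<exists>E\<ge>0. \<forall>x\<in>Y. \<forall>r>0. m (W x (2 * r)) \<le> ennreal E * m (W x r)"
proof -
  \<comment> \<open>For radius \<open>2 * r\<close>, \<open>W_big\<close> gives the level
    \<open>1 / (2 * k\<^sup>2 * r)\<close>, which is \<open>1 / r / l\<close>.\<close>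
  define l where "l = 2 * k\<^sup>2"
  have k2: "k \<le> k\<^sup>2" using k by (simp add: power2_eq_square)
  have l: "1 \<le> l" "k < l" using k k2 by (auto simp: l_def)
  define L where "L = 2 * k * l / \<tau>"
  have L0: "0 < L" using k l tau by (simp add: L_def)
  have Lk: "k < L"
  proof -
    have "k * \<tau> < k * (2 * l)" using tau l k by (intro mult_strict_left_mono) auto
    then show ?thesis using tau by (simp add: L_def field_simps)
  qed
  obtain E1 where E1: "E1 \<ge> 1" "\<And>x r. x \<in> X \<Longrightarrow> 0 < r \<Longrightarrow> b x (2 * k\<^sup>2 * r) \<le> E1 * b x r"
    using b_double_iter[of "2 * k\<^sup>2"] by blast
  obtain E2 where E2: "E2 \<ge> 1" "\<And>x r. x \<in> X \<Longrightarrow> 0 < r \<Longrightarrow> b x (k\<^sup>2 * r) \<le> E2 * b x r"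
    using b_double_iter[of "k\<^sup>2"] by blast
  \<comment> \<open>This radius factor fits the intermediate regime:
    \<open>1 < k * (2 * r * w x)\<close> means \<open>1 / (2 * k\<^sup>2) * k < r * w x\<close>, as
    \<open>qball_subset_W\<close> requires.\<close>
  have d: "0 < 1 / (2 * k\<^sup>2)" "1 / (2 * k\<^sup>2) * k \<le> 1" using k by (auto simp: power2_eq_square)
  obtain E3 where E3: "E3 \<ge> 0" "\<And>y. y \<in> Y \<Longrightarrow> 
      m {z \<in> X. w y / (L * l) \<le> w z} \<le> ennreal E3 * m (qball X \<rho> y (1 / (2 * k\<^sup>2) * w y))"
    using tail_le_qball[of "L * l", OF _ d] L0 l by auto
  obtain E4 where E4: "E4 \<ge> 0" "\<And>s x. 0 < s \<Longrightarrow> x \<in> X \<Longrightarrow> L * s \<le> w x \<Longrightarrow>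
      m {z \<in> X. s / l \<le> w z} \<le> ennreal E4 * m {z \<in> X. l * s < w z}"
    using tail_doubling[OF l(1)] unfolding L_def by blast
  define E where "E = max (E1 * E2\<^sup>2) (max E3 E4)"
  have "m (W x (2 * r)) \<le> ennreal E * m (W x r)" if x: "x \<in> Y" and r: "0 < r" for x r
  proof (cases "k * (2 * r * w x) \<le> 1")
    case True
    note small = W_small[OF x _ True]
    have wx: "0 < w x" "x \<in> X" using x by (auto simp: Y_def)
    \<comment> \<open>\<open>W x (2 * r)\<close> lies in the old ball of radius
      \<open>2 * q * (k * w x)\<close>, and \<open>W x r\<close> contains the one of radius
      \<open>q / k * w x\<close>; the ratio \<open>2 * k\<^sup>2\<close> of these radii is the
      factor in \<open>E1\<close>.\<close>
    define q where "q = r * w x"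
    have q: "0 < q" using wx r by (simp add: q_def)
    have "m (W x (2 * r)) \<le> ennreal (1 / (b c (w x / k))\<^sup>2) * emeasure M (W x (2 * r))"
      using small(1) k wx r by (intro m_le sets_W x) (auto simp: field_simps)
    also have "\<dots> \<le> ennreal (1 / (b c (w x / k))\<^sup>2) * emeasure M (qball X \<rho> x (2 * q * (k * w x)))"
      using small(2) r wx
      by (intro mult_left_mono emeasure_mono qball_sets subsetI)
        (auto simp: qball_def q_def mult.assoc, auto simp: W_def Y_def)
    also have "\<dots> = ennreal (1 / (b c (w x / k))\<^sup>2 * b x (2 * k\<^sup>2 * (q / k * w x)))"
      using wx k by (simp add: emeasure_qball ennreal_mult[symmetric] b_nonneg power2_eq_square mult_ac)
    also have "\<dots> \<le> ennreal (E1 * E2\<^sup>2 * (b x (q / k * w x) / (b c (k * w x))\<^sup>2))"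
    proof (rule ennreal_leI)
      have "b c (k * w x) \<le> E2 * b c (w x / k)"
        using E2(2)[OF c, of "w x / k"] wx k by (simp add: power2_eq_square)
      moreover have "0 < b c (w x / k)" "0 < b c (k * w x)" using wx k by (auto intro!: b_pos c)
      ultimately have "(b c (k * w x))\<^sup>2 \<le> E2\<^sup>2 * (b c (w x / k))\<^sup>2" 
        by (simp flip: power_mult_distrib)
      then have 1: "1 / (b c (w x / k))\<^sup>2 \<le> E2\<^sup>2 / (b c (k * w x))\<^sup>2"
        using \<open>0 < b c (w x / k)\<close> \<open>0 < b c (k * w x)\<close> by (simp add: field_simps)
      have 2: "b x (2 * k\<^sup>2 * (q / k * w x)) \<le> E1 * b x (q / k * w x)"
        using q k wx by (intro E1(2)) auto
      have "1 / (b c (w x / k))\<^sup>2 * b x (2 * k\<^sup>2 * (q / k * w x))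
        \<le> E2\<^sup>2 / (b c (k * w x))\<^sup>2 * (E1 * b x (q / k * w x))"
        using 1 2 E1 by (intro mult_mono) (auto simp: b_nonneg)
      then show "1 / (b c (w x / k))\<^sup>2 * b x (2 * k\<^sup>2 * (q / k * w x))
        \<le> E1 * E2\<^sup>2 * (b x (q / k * w x) / (b c (k * w x))\<^sup>2)" by (simp add: mult_ac)
    qed
    also have "\<dots> = ennreal (E1 * E2\<^sup>2) * ennreal (b x (q / k * w x) / (b c (k * w x))\<^sup>2)"
      using E1 by (intro ennreal_mult) (auto simp: b_nonneg)
    also have "\<dots> \<le> ennreal E * m (W x r)"
    proof (intro mult_mono)
      have q1: "q / k * k \<le> 1"
      proof -
        have "2 * q \<le> k * (2 * q)" using k q by simp
        then show ?thesis using True k q by (simp add: q_def mult.assoc)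
      qed
      have "m (qball X \<rho> x (q / k * w x)) \<le> m (W x r)"
        using q1 q k by (intro m_mono qball_subset_W x) (auto simp: q_def)
      then show "ennreal (b x (q / k * w x) / (b c (k * w x))\<^sup>2) \<le> m (W x r)"
        using m_qball_ge[OF x q1] by (rule order_trans[rotated])
    qed (auto simp: E_def intro!: ennreal_leI)
    finally show ?thesis .
  next
    case False
    have wx: "0 < w x" "x \<in> X" using x by (auto simp: Y_def)
    have "W x (2 * r) \<subseteq> {z \<in> X. 1 / r / l \<le> w z}"
      using W_big[OF x, of _ "2 * r"] False r
      by (auto simp: l_def W_def Y_def mult_ac)
    then have 1: "m (W x (2 * r)) \<le> m {z \<in> X. 1 / r / l \<le> w z}" by (rule m_mono)
    show ?thesis
    proof (cases "L * (1 / r) \<le> w x")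
      case True
      \<comment> \<open>Both weights exceed \<open>k / r\<close>, so \<open>r * w x * w z\<close> is
        larger than \<open>k * max (w x) (w z)\<close>, the bound of \<open>rho_le\<close>.\<close>
      have "{z \<in> X. l * (1 / r) < w z} \<subseteq> W x r"
      proof
        fix z assume z: "z \<in> {z \<in> X. l * (1 / r) < w z}"
        have a1: "k < r * w x"
          using Lk True r by (simp add: field_simps)
        have a2: "k < r * w z" using z l r by (simp add: field_simps)
        have wz: "0 < w z" using a2 k r by (metis less_le_trans less_trans zero_less_mult_pos zero_less_numeral)
        have "k * w z < r * w x * w z" using a1 wz by simp
        moreover have "k * w x < r * w x * w z" using mult_strict_right_mono[OF a2 wx(1)] by (simp add: mult_ac)
        moreover have "\<rho> x z \<le> k * max (w x) (w z)" using z wx rho_le by auto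
        ultimately have "\<rho> x z < r * w x * w z" by (auto simp: max_def split: if_splits)
        then show "z \<in> W x r" using wz z by (auto simp: W_def Y_def)
      qed
      then have 2: "m {z \<in> X. l * (1 / r) < w z} \<le> m (W x r)" by (rule m_mono)
      have "m {z \<in> X. 1 / r / l \<le> w z} \<le> ennreal E4 * m {z \<in> X. l * (1 / r) < w z}"
        using E4(2)[OF _ wx(2) True] r by simp
      also have "\<dots> \<le> ennreal E * m (W x r)"
        using 2 by (intro mult_mono) (auto simp: E_def intro!: ennreal_leI)
      finally show ?thesis by (rule order_trans[OF 1])
    next
      case F: False
      then have "w x / (L * l) \<le> 1 / r / l"
        using L0 l r by (simp add: field_simps)
      then have "m {z \<in> X. 1 / r / l \<le> w z} \<le> m {z \<in> X. w x / (L * l) \<le> w z}"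
        by (intro m_mono) auto
      also have "\<dots> \<le> ennreal E3 * m (qball X \<rho> x (1 / (2 * k\<^sup>2) * w x))" by (rule E3(2)[OF x])
      also have "\<dots> \<le> ennreal E * m (W x r)"
      proof (intro mult_mono)
        have "1 / (2 * k\<^sup>2) * k \<le> r * w x"
          using False k by (simp add: field_simps power2_eq_square)
        then show "m (qball X \<rho> x (1 / (2 * k\<^sup>2) * w x)) \<le> m (W x r)"
          by (intro m_mono qball_subset_W x d)
      qed (auto simp: E_def intro!: ennreal_leI)
      finally show ?thesis by (rule order_trans[OF 1])
    qed
  qed
  moreover have "0 \<le> E" using E3(1) by (simp add: E_def)
  ultimately show ?thesis by blast
qed

section \<open>Finiteness, positivity and topology of the new balls\<close>

lemma m_tail_finite: "0 < s \<Longrightarrow> A \<subseteq> {z \<in> X. s \<le> w z} \<Longrightarrow> m A < \<infinity>"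
  using order_le_less_trans[OF order_trans[OF m_mono m_tail_le] ennreal_less_top] by simp

text \<open>In either regime the weights on \<open>W x r\<close> stay above a positive level, so the
  ball lies in a tail.\<close>

lemma m_W_finite:
  assumes "x \<in> Y" "0 < r"
  shows "m (W x r) < \<infinity>"
proof (cases "k * (r * w x) \<le> 1")
  case True
  then have "W x r \<subseteq> {z \<in> X. w x / k \<le> w z}"
    using W_small(1)[OF assms(1) _ True assms(2)] k by (auto simp: W_def Y_def field_simps)
  then show ?thesis using assms k by (intro m_tail_finite[of "w x / k"]) (auto simp: Y_def)
next
  case False
  then have "W x r \<subseteq> {z \<in> X. 1 / (k\<^sup>2 * r) \<le> w z}"
    using W_big[OF assms(1) _ _ assms(2)] by (auto simp: W_def Y_def)
  then show ?thesis using assms k by (intro m_tail_finite[of "1 / (k\<^sup>2 * r)"]) auto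
qed

lemma W_contains_qball:
  assumes "x \<in> Y" "0 < r"
  obtains \<delta> where "0 < \<delta>" "\<delta> * k \<le> 1" "qball X \<rho> x (\<delta> * w x) \<subseteq> W x r"
proof (rule that)
  let ?d = "min 1 (r * w x) / k"
  show "0 < ?d" "?d * k \<le> 1" using k assms by (auto simp: Y_def)
  then show "qball X \<rho> x (?d * w x) \<subseteq> W x r"
    using assms k by (intro qball_subset_W) auto
qed

lemma m_W_pos:
  assumes "x \<in> Y" "0 < r"
  shows "0 < m (W x r)"
proof -
  obtain \<delta> where d: "0 < \<delta>" "\<delta> * k \<le> 1" "qball X \<rho> x (\<delta> * w x) \<subseteq> W x r"
    using W_contains_qball[OF assms] .
  have "0 < m (qball X \<rho> x (\<delta> * w x))" using m_qball_pos[OF assms(1) d(1,2)] .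
  also have "\<dots> \<le> m (W x r)" using d(3) by (rule m_mono)
  finally show ?thesis .
qed

lemma qball_contains_W:
  assumes "x \<in> Y" "0 < s"
  obtains r where "0 < r" "W x r \<subseteq> qball X \<rho> x s"
proof (rule that)
  have wx: "0 < w x" using assms by (simp add: Y_def)
  \<comment> \<open>The first entry of the minimum puts the new ball in the small regime, the second
    makes the radius from \<open>W_small\<close> at most \<open>s\<close>.\<close>
  let ?r = "min (1 / (k * w x)) (s / (k * w x * w x))"
  show r: "0 < ?r" using wx assms k by simp
  have 1: "k * (?r * w x) \<le> 1" 
    using mult_left_mono[of ?r "1 / (k * w x)" "k * w x"] wx k by (simp add: mult_ac)
  have 2: "?r * w x * (k * w x) \<le> s" 
    using mult_left_mono[of ?r "s / (k * w x * w x)" "k * w x * w x"] wx k by (simp add: mult_ac)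
  show "W x ?r \<subseteq> qball X \<rho> x s"
    using W_small(2)[OF assms(1) _ 1 r] 2 by (force simp: W_def Y_def qball_def)
qed

text \<open>Every old ball about a point of \<open>Y\<close> contains a new one and conversely, so
  both kinds induce the same topology on \<open>Y\<close>.\<close>

lemma openin_iff_W:
  assumes "U \<subseteq> Y"
  shows "openin (qtopology X \<rho>) U \<longleftrightarrow> (\<forall>x\<in>U. \<exists>r>0. W x r \<subseteq> U)"
proof -
  have "(\<exists>r>0. qball X \<rho> x r \<subseteq> U) \<longleftrightarrow> (\<exists>r>0. W x r \<subseteq> U)" if xU: "x \<in> U" for x
  proof
    assume "\<exists>r>0. qball X \<rho> x r \<subseteq> U"
    then obtain r where r: "0 < r" "qball X \<rho> x r \<subseteq> U" by blast
    obtain q where "0 < q" "W x q \<subseteq> qball X \<rho> x r"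
      using qball_contains_W[OF subsetD[OF assms xU] r(1)] .
    then show "\<exists>r>0. W x r \<subseteq> U" using r by blast
  next
    assume "\<exists>r>0. W x r \<subseteq> U"
    then obtain r where r: "0 < r" "W x r \<subseteq> U" by blast
    have x: "x \<in> Y" using xU assms by blast
    obtain \<delta> where "0 < \<delta>" "qball X \<rho> x (\<delta> * w x) \<subseteq> W x r"
      using W_contains_qball[OF x r(1)] by metis
    then show "\<exists>r>0. qball X \<rho> x r \<subseteq> U" using r x
      by (intro exI[of _ "\<delta> * w x"]) (auto simp: Y_def)
  qed
  then show ?thesis using assms unfolding openin_qtopology by (auto simp: Y_def)
qed

lemma openin_Y: "openin (qtopology X \<rho>) Y"
  unfolding openin_iff_W[OF order_refl] by (auto simp: W_def intro!: exI[of _ 1])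

section \<open>Borel regularity of the new measure\<close>

lemma openin_borel: "openin (qtopology X \<rho>) U \<Longrightarrow> U \<in> qborel_sets X \<rho>"
  by (auto simp: qborel_sets_def)

lemma borel_sets_M: "qborel_sets X \<rho> \<subseteq> sets M"
  using D by (simp add: doubling_measure_coeff_def)

text \<open>Where \<open>M\<close> is infinite, its Borel regularity alone says nothing about null sets;
  one cuts the set into pieces inside balls.\<close>

lemma borel_hull:
  assumes "A \<in> sets M"
  obtains B where "B \<in> qborel_sets X \<rho>" "A \<subseteq> B" "B - A \<in> null_sets M"
proof -
  define A' where "A' n = A \<inter> qball X \<rho> c (real n)" for n
  have A': "A' n \<in> sets M" for n using assms qball_sets[OF c] by (simp add: A'_def)
  have "\<exists>B\<in>qborel_sets X \<rho>. A' n \<subseteq> B \<and> emeasure M B = emeasure M (A' n)" for n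
    using D A' unfolding doubling_measure_coeff_def by blast
  then obtain B where B: "\<And>n. B n \<in> qborel_sets X \<rho>" "\<And>n. A' n \<subseteq> B n"
    "\<And>n. emeasure M (B n) = emeasure M (A' n)" by metis
  interpret X: sigma_algebra X "qborel_sets X \<rho>" by (rule sigma_algebra_qborel)
  have null: "B n - A' n \<in> null_sets M" for n
  proof (rule null_setsI)
    have Bn: "B n \<in> sets M" using B(1) borel_sets_M by blast
    then show "B n - A' n \<in> sets M" using A' by blast
    have "emeasure M (A' n) \<le> ennreal (b c n)"
      unfolding emeasure_qball[OF c, symmetric] A'_def
      using qball_sets[OF c] by (intro emeasure_mono) auto
    then have "emeasure M (A' n) \<noteq> \<infinity>" by (auto simp: top_unique)
    then show "emeasure M (B n - A' n) = 0"
      using emeasure_Diff[of M "A' n" "B n"] A' Bn B(2,3) by simp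
  qed
  show ?thesis
  proof (rule that)
    show BB: "(\<Union>n. B n) \<in> qborel_sets X \<rho>" using B(1) by blast
    have "A \<subseteq> (\<Union>n. A' n)"
      using sets.sets_into_space[OF assms] reals_Archimedean2
      by (force simp: A'_def qball_def space_M)
    then show "A \<subseteq> (\<Union>n. B n)" using B(2) by blast
    have "(\<Union>n. B n) - A \<subseteq> (\<Union>n. B n - A' n)" by (auto simp: A'_def)
    moreover have "(\<Union>n. B n - A' n) \<in> null_sets M" using null by auto
    moreover have "(\<Union>n. B n) - A \<in> sets M" using BB borel_sets_M assms by blast
    ultimately show "(\<Union>n. B n) - A \<in> null_sets M" by (metis null_sets_subset)
  qed
qed

text \<open>The hull exceeds \<open>A\<close> by an \<open>M\<close>-null set, and \<open>m\<close>
  is an integral against \<open>M\<close>, so the excess has no new mass. Cutting with the open set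
  \<open>Y\<close> keeps the hull Borel.\<close>

lemma m_borel_hull:
  assumes "A \<in> sets M" "A \<subseteq> Y"
  obtains B where "B \<in> qborel_sets X \<rho>" "A \<subseteq> B" "B \<subseteq> Y" "m B = m A"
proof -
  obtain B where B: "B \<in> qborel_sets X \<rho>" "A \<subseteq> B" "B - A \<in> null_sets M"
    using borel_hull[OF assms(1)] .
  interpret X: sigma_algebra X "qborel_sets X \<rho>" by (rule sigma_algebra_qborel)
  show ?thesis
  proof (rule that)
    show "B \<inter> Y \<in> qborel_sets X \<rho>" using B(1) openin_borel[OF openin_Y] by blast
    show "A \<subseteq> B \<inter> Y" using B assms by blast
    show "m (B \<inter> Y) = m A" unfolding m_def
    proof (rule nn_integral_cong_AE)
      show "AE z in M. 1 / (emeasure M (qball X \<rho> c (w z)))\<^sup>2 * indicator (B \<inter> Y) z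
        = 1 / (emeasure M (qball X \<rho> c (w z)))\<^sup>2 * indicator A z"
        using AE_not_in[OF B(3)] by eventually_elim (use B(2) assms in \<open>auto simp: indicator_def\<close>)
    qed
  qed auto
qed

end

section \<open>Flattening and sphericalization as weighted spaces\<close>

theorem theorem4p1:
  fixes X :: "'a set" and \<rho> :: "'a \<Rightarrow> 'a \<Rightarrow> real" and \<mu> :: "'a measure"
    and K \<tau> C\<^sub>\<mu> :: real
  assumes "quasi_metric_on K X \<rho>"
    and "uniformly_perfect \<tau> X \<rho>"
    and "doubling_measure_coeff C\<^sub>\<mu> X \<rho> \<mu>"
  shows "(\<forall>c\<in>X. qbounded X \<rho> \<longrightarrow>
            doubling_measure (flat_space X c) (flat_dist \<rho> c) (flat_measure X \<rho> \<mu> c)) \<and>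
         (\<forall>a\<in>X. \<not> qbounded X \<rho> \<longrightarrow>
            doubling_measure (sph_space X) (sph_dist \<rho> a) (sph_measure X \<rho> \<mu> a))"
proof (intro conjI ballI impI)
  fix c assume c: "c \<in> X"
  \<comment> \<open>With \<open>t = 0\<close> the points of positive weight are those other than
    \<open>c\<close>.\<close>
  interpret weighted_space X \<rho> \<mu> K \<tau> C\<^sub>\<mu> 0 c
    using assms c by (simp add: weighted_space_def)
  let ?N = "flat_measure X \<rho> \<mu> c" and ?d = "flat_dist \<rho> c"
  have w: "w x = \<rho> c x" for x by (simp add: w_def)
  have FY: "flat_space X c = Y"
    using rho(1)[OF c] rho(3)[OF c] c by (force simp: flat_space_def Y_def w less_le)
  have m: "emeasure ?N A = m A" if "A \<in> sets \<mu>" "A \<subseteq> Y" for A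
    using emeasure_flat_measure[OF D Q c that(1)] that(2) by (simp add: m_def w FY)
  have N: "sets ?N = {A \<in> sets \<mu>. A \<subseteq> Y}" using sets_flat_measure(2)[OF D Q c] FY by simp
  have ball: "qball Y ?d x r = W x r" if "x \<in> Y" for x r
    using that rho(2) c unfolding qball_def W_def flat_dist_def
    by (auto simp: w Y_def field_simps)
  \<comment> \<open>Flattened balls are the sets \<open>W x r\<close>, so
    \<open>openin_iff_W\<close> identifies the topologies; Borel sets then transfer along the
    identity map.\<close>
  have op: "openin (qtopology Y ?d) U \<longleftrightarrow> U \<subseteq> Y \<and> openin (qtopology X \<rho>) U" for U
    using openin_iff_W[of U] ball unfolding openin_qtopology[of Y] by (metis subsetD)
  have YB: "Y \<in> qborel_sets X \<rho>" using openin_Y by (rule openin_borel)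
  show "doubling_measure (flat_space X c) ?d ?N"
    unfolding FY
  proof (rule doubling_measureI)
    show "space ?N = Y"
      using Y_X by (auto simp: flat_measure_def space_restrict_space FY space_M)
    have "A \<in> qborel_sets X \<rho>" "A \<subseteq> Y" if "A \<in> qborel_sets Y ?d" for A
    proof -
      show "A \<subseteq> Y" using that sigma_algebra_qborel[of Y ?d]
        by (auto simp: sigma_algebra_iff2)
      then show "A \<in> qborel_sets X \<rho>"
        using qborel_sets_vimage_Int[of Y ?d "\<lambda>x. x" Y X \<rho> A] that YB op openin_borel
        by (simp add: Int_absorb2)
    qed
    then show "qborel_sets Y ?d \<subseteq> sets ?N" using borel_sets_M N by auto
  next
    fix A assume "A \<in> sets ?N"
    then have A: "A \<in> sets \<mu>" "A \<subseteq> Y" using N by auto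
    obtain B where B: "B \<in> qborel_sets X \<rho>" "A \<subseteq> B" "B \<subseteq> Y" "m B = m A"
      using m_borel_hull[OF A] .
    have "U \<inter> Y \<in> qborel_sets Y ?d" if "openin (qtopology X \<rho>) U" for U
      using op[of "U \<inter> Y"] that openin_Y by (auto simp: qborel_sets_def)
    then have "B \<in> qborel_sets Y ?d"
      using qborel_sets_image_Int[of X \<rho> "\<lambda>x. x" Y Y ?d B] B op[of Y] openin_Y Y_X
      by (auto simp: Int_absorb2 qborel_sets_def)
    then show "\<exists>B\<in>qborel_sets Y ?d. A \<subseteq> B \<and> emeasure ?N B = emeasure ?N A"
      using B A m borel_sets_M by (intro bexI[of _ B]) auto
  next
    have WY: "W x r \<subseteq> Y" for x r by (auto simp: W_def)
    have mW: "emeasure ?N (qball Y ?d x r) = m (W x r)" if "x \<in> Y" for x r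
      using ball[OF that] m[OF sets_W[OF that] WY] by simp
    show "qball Y ?d x r \<in> sets ?N" if "x \<in> Y" for x r
      using ball[OF that] sets_W[OF that] WY N by auto
    show "0 < emeasure ?N (qball Y ?d x r)" "emeasure ?N (qball Y ?d x r) < \<infinity>" 
      if "x \<in> Y" "0 < r" for x r
      using m_W_pos m_W_finite that mW by auto
    show "\<exists>E. \<forall>x\<in>Y. \<forall>r>0. emeasure ?N (qball Y ?d x (2 * r)) \<le> ennreal E * emeasure ?N (qball Y ?d x r)"
      using W_doubling mW by auto
  qed
next
  fix a assume a: "a \<in> X" and unbdd: "\<not> qbounded X \<rho>"
  \<comment> \<open>With \<open>t = 1\<close> every point has weight at least 1, hence
    \<open>Y = X\<close>; the added point \<open>None\<close> is treated separately.\<close>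
  interpret weighted_space X \<rho> \<mu> K \<tau> C\<^sub>\<mu> 1 a
    using assms a by (simp add: weighted_space_def)
  let ?N = "sph_measure X \<rho> \<mu> a" and ?d = "sph_dist \<rho> a" and ?Z = "sph_space X"
  have w: "w x = 1 + \<rho> a x" for x by (simp add: w_def)
  have w1: "1 \<le> w x" if "x \<in> X" for x using w_ge[OF that] .
  have XY: "Y = X" using w1 by (force simp: Y_def)
  have m: "emeasure ?N A = m (Some -` A)" if "A \<subseteq> ?Z" "Some -` A \<in> sets \<mu>" for A
    using emeasure_sph_measure[OF D Q a that] by (simp add: m_def w)
  have N: "sets ?N = {A. A \<subseteq> ?Z \<and> Some -` A \<in> sets \<mu>}" by (rule sets_sph_measure[OF space_M])
  \<comment> \<open>A bound on the weights would bound \<open>\<rho>\<close> through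
    \<open>rho_le\<close>. Points of large weight are the ones that fill the balls about
    \<open>None\<close>.\<close>
  have big: "\<exists>x\<in>X. s \<le> w x" for s
  proof (rule ccontr)
    assume "\<not> ?thesis"
    then have s: "\<And>x. x \<in> X \<Longrightarrow> w x < s" by force
    have "\<rho> x y \<le> k * s" if "x \<in> X" "y \<in> X" for x y
    proof -
      have "\<rho> x y \<le> k * max (w x) (w y)" by (rule rho_le[OF that])
      also have "\<dots> \<le> k * s" using s[OF that(1)] s[OF that(2)] k by (intro mult_left_mono) auto
      finally show ?thesis .
    qed
    then show False using unbdd unfolding qbounded_def by blast
  qed
  have ball_Some: "Some -` qball ?Z ?d (Some x) r = W x r" if "x \<in> X" for x r
    using that rho(2)[OF a] w1 unfolding qball_def W_def XY sph_space_def
    by (auto simp: w XY pos_divide_less_eq add_pos_nonneg rho(1) a mult.assoc)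
  \<comment> \<open>A point \<open>y\<close> has distance \<open>1 / w y\<close> from
    \<open>None\<close>, so balls about infinity trace tails on \<open>X\<close>.\<close>
  have ball_None: "Some -` qball ?Z ?d None r = {z \<in> X. 1 / r < w z}" if "0 < r" for r
  proof -
    have "1 / (1 + \<rho> y a) < r \<longleftrightarrow> 1 / r < w y" if y: "y \<in> X" for y
    proof -
      have "0 < w y" "1 + \<rho> y a = w y" using w1[OF y] rho(2)[OF a y] by (auto simp: w)
      then show ?thesis using \<open>0 < r\<close> by (simp add: field_simps)
    qed
    then show ?thesis unfolding qball_def sph_space_def by auto
  qed
  have None_ball: "None \<in> qball ?Z ?d None r" if "0 < r" for r
    using that by (simp add: qball_def sph_space_def)
  \<comment> \<open>\<open>None\<close> is at distance exactly \<open>1 / w x\<close> from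
    \<open>Some x\<close>, so radii up to that value exclude it.\<close>
  have small_ball: "qball ?Z ?d (Some x) r \<subseteq> Some ` X" if "x \<in> X" "r \<le> 1 / w x" for x r
    using that rho(2)[OF a] unfolding qball_def sph_space_def by (auto simp: w)
  have ballZ: "qball ?Z ?d x r \<subseteq> ?Z" for x r by (auto simp: qball_def)
  have open_vimage: "openin (qtopology X \<rho>) (Some -` U)" if "openin (qtopology ?Z ?d) U" for U
  proof (subst openin_iff_W)
    have U: "U \<subseteq> ?Z" and r: "\<And>x. x \<in> U \<Longrightarrow> \<exists>r>0. qball ?Z ?d x r \<subseteq> U"
      using that unfolding openin_qtopology by auto
    show UX: "Some -` U \<subseteq> Y" using U by (auto simp: sph_space_def XY)
    show "\<forall>x\<in>Some -` U. \<exists>r>0. W x r \<subseteq> Some -` U"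
    proof
      fix x assume x: "x \<in> Some -` U"
      then obtain r where "0 < r" "qball ?Z ?d (Some x) r \<subseteq> U" using r by auto
      moreover have "x \<in> X" using x UX XY by blast
      ultimately show "\<exists>r>0. W x r \<subseteq> Some -` U" using ball_Some[of x r] by blast
    qed
  qed
  have open_image: "openin (qtopology ?Z ?d) (Some ` U)" if U: "openin (qtopology X \<rho>) U" for U
    unfolding openin_qtopology
  proof (intro conjI ballI)
    have UX: "U \<subseteq> X" using U unfolding openin_qtopology by blast
    then show "Some ` U \<subseteq> ?Z" by (auto simp: sph_space_def)
    fix y assume "y \<in> Some ` U"
    then obtain x where x: "y = Some x" "x \<in> U" "x \<in> X" using UX by blast
    obtain r where r: "0 < r" "W x r \<subseteq> U" using openin_iff_W[of U] U UX XY x by auto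
    let ?q = "min r (1 / w x)"
    have "W x ?q \<subseteq> W x r"
    proof
      fix z assume "z \<in> W x ?q"
      moreover from this have "?q * w x * w z \<le> r * w x * w z"
        using w1[OF x(3)] by (intro mult_right_mono) (auto simp: W_def Y_def)
      ultimately show "z \<in> W x r" by (auto simp: W_def)
    qed
    then have "Some -` qball ?Z ?d y ?q \<subseteq> U" using ball_Some[OF x(3)] x(1) r(2) by simp
    moreover have "qball ?Z ?d y ?q \<subseteq> Some ` X" using small_ball[OF x(3)] x(1) by simp
    ultimately have "qball ?Z ?d y ?q \<subseteq> Some ` U" by blast
    moreover have "0 < ?q" using r w1[OF x(3)] by simp
    ultimately show "\<exists>r>0. qball ?Z ?d y r \<subseteq> Some ` U" by blast
  qed
  interpret Z: sigma_algebra ?Z "qborel_sets ?Z ?d" by (rule sigma_algebra_qborel)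
  have XB: "X \<in> qborel_sets X \<rho>" and openX: "openin (qtopology X \<rho>) X"
    using openin_Y openin_borel XY by auto
  have open_borel: "U \<in> qborel_sets ?Z ?d" if "openin (qtopology ?Z ?d) U" for U
    using that by (auto simp: qborel_sets_def)
  have XZ: "Some ` X \<in> qborel_sets ?Z ?d" using open_borel[OF open_image[OF openX]] .
  have "?Z - Some ` X = {None}" by (auto simp: sph_space_def)
  then have NZ: "{None} \<in> qborel_sets ?Z ?d" using XZ Z.compl_sets by metis
  show "doubling_measure ?Z ?d ?N"
  proof (rule doubling_measureI)
    have "Some -` ?Z = space \<mu>" by (auto simp: sph_space_def space_M)
    then have "?Z \<in> sets ?N" using N by auto
    moreover have "space ?N \<in> sets ?N" by (rule sets.top)
    ultimately show "space ?N = ?Z" using N sets.sets_into_space[of ?Z ?N] by blast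
    have "Some -` A \<in> qborel_sets X \<rho>" if A: "A \<in> qborel_sets ?Z ?d" for A
    proof -
      have "Some -` A \<inter> X = Some -` A" using Z.sets_into_space[OF A] by (auto simp: sph_space_def)
      moreover have "Some -` U \<inter> X \<in> qborel_sets X \<rho>" if "openin (qtopology ?Z ?d) U" for U
        using openin_borel[OF openin_Int[OF open_vimage[OF that] openX]] .
      ultimately show ?thesis
        using qborel_sets_vimage_Int[of ?Z ?d Some X X \<rho> A] XB A by (auto simp: sph_space_def)
    qed
    then show "qborel_sets ?Z ?d \<subseteq> sets ?N" using borel_sets_M Z.sets_into_space unfolding N by blast
  next
    fix A assume "A \<in> sets ?N"
    then have A: "A \<subseteq> ?Z" "Some -` A \<in> sets \<mu>" "Some -` A \<subseteq> Y" 
      using N XY by (auto simp: sph_space_def)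
    obtain B where B: "B \<in> qborel_sets X \<rho>" "Some -` A \<subseteq> B" "B \<subseteq> Y" "m B = m (Some -` A)"
      using m_borel_hull[OF A(2,3)] .
    have "Some ` (U \<inter> X) \<in> qborel_sets ?Z ?d" if "openin (qtopology X \<rho>) U" for U
      using open_borel[OF open_image[OF openin_Int[OF that openX]]] .
    then have "Some ` (B \<inter> X) \<in> qborel_sets ?Z ?d"
      using qborel_sets_image_Int[of X \<rho> Some X ?Z ?d B] B(1) XZ by simp
    moreover have "B \<inter> X = B" using B(3) XY by blast
    \<comment> \<open>The hull receives \<open>None\<close> only if \<open>A\<close> contains it;
      this leaves the mass unchanged, since the mass depends on the preimage under
      \<open>Some\<close> alone.\<close>
    moreover have "A \<inter> {None} \<in> qborel_sets ?Z ?d"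
      using NZ Z.empty_sets by (cases "None \<in> A") auto
    ultimately have B': "Some ` B \<union> (A \<inter> {None}) \<in> qborel_sets ?Z ?d" by auto
    have "A \<subseteq> Some ` B \<union> (A \<inter> {None})"
    proof
      fix y assume "y \<in> A" then show "y \<in> Some ` B \<union> (A \<inter> {None})" using B(2) by (cases y) auto
    qed
    moreover have "Some -` (Some ` B \<union> (A \<inter> {None})) = B" by auto
    moreover have "B \<in> sets \<mu>" using B(1) borel_sets_M by blast
    ultimately show "\<exists>B\<in>qborel_sets ?Z ?d. A \<subseteq> B \<and> emeasure ?N B = emeasure ?N A"
      using B' m[of A] m[of "Some ` B \<union> (A \<inter> {None})"] A B(4) Z.sets_into_space[OF B']
      by (intro bexI[OF _ B']) simp
  next
    have sets_tail: "{z \<in> X. s < w z} \<in> sets \<mu>" for s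
      unfolding space_M[symmetric] by measurable
    have sets_ball: "Some -` qball ?Z ?d x r \<in> sets \<mu>" if "x \<in> ?Z" "0 < r" for x r
      using that ball_Some ball_None sets_W XY sets_tail by (cases x) (auto simp: sph_space_def)
    show "qball ?Z ?d x r \<in> sets ?N" if "x \<in> ?Z" "0 < r" for x r
      using sets_ball[OF that] N ballZ by auto
    have m_Some: "emeasure ?N (qball ?Z ?d (Some x) r) = m (W x r)" if "x \<in> X" for x r
      using m[OF ballZ, of "Some x" r] ball_Some[OF that] sets_W that XY by simp
    have m_None: "emeasure ?N (qball ?Z ?d None r) = m {z \<in> X. 1 / r < w z}" if "0 < r" for r
      using m[OF ballZ, of None r] ball_None[OF that] sets_tail by simp
    show "emeasure ?N (qball ?Z ?d x r) < \<infinity>" if "x \<in> ?Z" "0 < r" for x r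
    proof (cases x)
      case None
      show ?thesis unfolding None m_None[OF that(2)] using that
        by (intro m_tail_finite[of "1 / r"]) auto
    next
      case (Some y)
      then show ?thesis using m_Some m_W_finite that XY by (auto simp: sph_space_def)
    qed
    \<comment> \<open>Applied with \<open>s = 1 / r\<close>: doubling the radius about infinity
      halves the level. The tail \<open>s / 2 \<le> w z\<close> contains the trace of the doubled
      ball, and the tail \<open>2 * s < w z\<close> lies in that of the original one.\<close>
    obtain E1 where E1: "E1 \<ge> 0" "\<And>s x. 0 < s \<Longrightarrow> x \<in> X \<Longrightarrow> 2 * k * 2 / \<tau> * s \<le> w x \<Longrightarrow>
        m {z \<in> X. s / 2 \<le> w z} \<le> ennreal E1 * m {z \<in> X. 2 * s < w z}"
      using tail_doubling[of 2] by auto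
    have None_doubling: "m {z \<in> X. 1 / (2 * r) < w z} \<le> ennreal E1 * m {z \<in> X. 1 / r < w z}"
      if r: "0 < r" for r
    proof -
      obtain x where "x \<in> X" "2 * k * 2 / \<tau> * (1 / r) \<le> w x" using big by blast
      then have 1: "m {z \<in> X. 1 / r / 2 \<le> w z} \<le> ennreal E1 * m {z \<in> X. 2 * (1 / r) < w z}"
        using E1(2)[of "1 / r" x] r by auto
      have "1 / r \<le> 2 * (1 / r)" using r by (simp add: field_simps)
      have "m {z \<in> X. 1 / (2 * r) < w z} \<le> m {z \<in> X. 1 / r / 2 \<le> w z}"
        by (intro m_mono) (auto simp: mult.commute)
      also note 1
      also have "ennreal E1 * m {z \<in> X. 2 * (1 / r) < w z} \<le> ennreal E1 * m {z \<in> X. 1 / r < w z}"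
        using \<open>1 / r \<le> 2 * (1 / r)\<close> by (intro mult_left_mono m_mono) auto
      finally show ?thesis .
    qed
    obtain E2 where E2: "\<And>x r. x \<in> Y \<Longrightarrow> 0 < r \<Longrightarrow> m (W x (2 * r)) \<le> ennreal E2 * m (W x r)"
      using W_doubling by blast
    show "0 < emeasure ?N (qball ?Z ?d x r)" if "x \<in> ?Z" "0 < r" for x r
    proof (cases x)
      case None
      \<comment> \<open>On the old ball of radius \<open>w y / k\<close> about \<open>y\<close> the
        weights are at least \<open>w y / k\<close>, hence at least \<open>1 / r + 1\<close>; the
        summand 1 provides the strict inequality of the tail.\<close>
      obtain y where y: "y \<in> X" "k * (1 / r + 1) \<le> w y" using big by blast
      have kk: "0 < 1 / k" "1 / k * k \<le> 1" using k by auto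
      have "0 < m (qball X \<rho> y (1 / k * w y))"
        using m_qball_pos[OF _ kk, of y] y XY by simp
      also have "\<dots> \<le> m {z \<in> X. 1 / r < w z}"
      proof (intro m_mono subsetI)
        fix z assume "z \<in> qball X \<rho> y (1 / k * w y)"
        then have z: "z \<in> X" "w y \<le> k * w z"
          using near(1)[OF _ _ _ kk(2), of y z] y XY by (auto simp: qball_def)
        have "k * (1 / r + 1) \<le> k * w z" using y z by linarith
        then have "1 / r + 1 \<le> w z" using k by simp
        then show "z \<in> {z \<in> X. 1 / r < w z}" using z by simp
      qed
      finally show ?thesis unfolding None m_None[OF that(2)] .
    next
      case (Some y)
      then show ?thesis using m_Some m_W_pos that XY by (auto simp: sph_space_def)
    qed
    show "\<exists>E. \<forall>x\<in>?Z. \<forall>r>0. emeasure ?N (qball ?Z ?d x (2 * r)) \<le> ennreal E * emeasure ?N (qball ?Z ?d x r)"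
    proof (intro exI[of _ "max E1 E2"] ballI allI impI)
      fix x r assume x: "x \<in> ?Z" and r: "0 < (r::real)"
      show "emeasure ?N (qball ?Z ?d x (2 * r)) \<le> ennreal (max E1 E2) * emeasure ?N (qball ?Z ?d x r)"
      proof (cases x)
        case None
        have "m {z \<in> X. 1 / (2 * r) < w z} \<le> ennreal (max E1 E2) * m {z \<in> X. 1 / r < w z}"
          using None_doubling[OF r] by (rule order_trans) (intro mult_right_mono ennreal_leI, auto)
        then show ?thesis using None m_None r by simp
      next
        case (Some y)
        then have y: "y \<in> X" using x by (auto simp: sph_space_def)
        then have yY: "y \<in> Y" by (simp only: XY)
        have "m (W y (2 * r)) \<le> ennreal (max E1 E2) * m (W y r)"
          using E2[OF yY r] by (rule order_trans) (intro mult_right_mono ennreal_leI, auto)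
        then show ?thesis using Some m_Some[OF y] by simp
      qed
    qed
  qed
qed

end
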